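(* Let $(U_t,V_t)_{t\in\mathbb{Z}^+}$ be a Markov chain on the strip $\mathcal{A}\times\mathbb{Z}$, where $\mathcal{A} = \{0,1,\ldots,k-1\}$ for some $k \in \mathbb{N}$ or $\mathcal{A}=\mathbb{Z}^+$, with transition probabilities $$\mathbb{P} [ (U_{t+1}, V_{t+1} ) = (\ell', x + d) \mid U_t =\ell, V_t =x ] = \phi ( \ell, \ell'; d)$$ not depending on $x$, and suppose that the induced Markov chain $(U_t)$ on $\mathcal{A}$ is irreducible and positive-recurrent. Suppose that there exist $\alpha \in (0,1)$, $\beta > \alpha$, and $C < \infty$ such that (i) $M_\ell^- (\beta) \leq C$ for all $\ell \in \mathcal{A}$; (ii) $$\lim_{x \to \infty} \frac{ \log T_0^+ (x)}{\log x} = -\alpha;$$ and (iii) $M_\ell^+ (\beta) \leq C$ for all $\ell \in \mathcal{A}$ with $\ell \neq 0$. Then $V_t \to +\infty$ a.s. as $t \to \infty$, and, moreover, $$\lim_{t \to \infty} \frac{ \log V_t}{\log t} = \frac{1}{\alpha} \quad \text{a.s.}$$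
   Context: $\mathbb{Z}^+ = \{0,1,2,\ldots\}$, $\mathbb{N}=\{1,2,\ldots\}$. For real $x$, $x^+ := x \mathbf{1}\{x>0\}$ and $x^- := -x\mathbf{1}\{x<0\}$. Because the transition probabilities depend only on $\ell,\ell',d$, the projection $(U_t)$ is itself a Markov chain on $\mathcal{A}$, with transition probabilities $q_{\ell,\ell'} = \sum_{d\in\mathbb{Z}}\phi(\ell,\ell';d)$ (the induced chain). For $x \geq 0$, $\ell\in\mathcal{A}$ and $\beta>0$, $$T_\ell^\pm (x) := \mathbb{P} [ (V_{t+1} - V_t)^\pm > x \mid U_t = \ell, V_t = z ], \qquad M_\ell ^\pm (\beta ) := \mathbb{E} [ ( (V_{t+1} - V_t)^\pm )^\beta \mid U_t = \ell, V_t = z ],$$ which do not depend on $z$ or $t$. *)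

theory Defs
  imports "HOL-Probability.Probability"
begin

text \<open>
  Transition kernels of time-homogeneous Markov chains on a countable state space are functions
  \<open>K :: 's \<Rightarrow> 's pmf\<close>; \<open>trajectory K n i\<close> is the law of $(X_1, \ldots, X_n)$ given $X_0 = i$.
\<close>

primrec trajectory :: "('s \<Rightarrow> 's pmf) \<Rightarrow> nat \<Rightarrow> 's \<Rightarrow> 's list pmf" where
  "trajectory K 0 i = return_pmf []"
| "trajectory K (Suc n) i =
     bind_pmf (K i) (\<lambda>j. bind_pmf (trajectory K n j) (\<lambda>xs. return_pmf (j # xs)))"

text \<open>
  The state at time $n$ is \<open>last (i # xs)\<close>, with \<open>i\<close> in front to cover $n = 0$.
\<close>

definition irreducible_chain :: "'s set \<Rightarrow> ('s \<Rightarrow> 's pmf) \<Rightarrow> bool" where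
  "irreducible_chain S K \<longleftrightarrow>
     (\<forall>i\<in>S. \<forall>j\<in>S. \<exists>n. measure_pmf.prob (trajectory K n i) {xs. last (i # xs) = j} > 0)"

text \<open>
  The probability that $\tau_i = n$ given $X_0 = i$, where $\tau_i = \inf \{n \geq 1 : X_n = i\}$.
\<close>

definition return_time_prob :: "('s \<Rightarrow> 's pmf) \<Rightarrow> 's \<Rightarrow> nat \<Rightarrow> real" where
  "return_time_prob K i n =
     measure_pmf.prob (trajectory K n i) {xs. xs \<noteq> [] \<and> last xs = i \<and> i \<notin> set (butlast xs)}"

text \<open>
  $\tau_i$ is almost surely finite and has finite expectation.
\<close>

definition positive_recurrent_chain :: "'s set \<Rightarrow> ('s \<Rightarrow> 's pmf) \<Rightarrow> bool" where
  "positive_recurrent_chain S K \<longleftrightarrow>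
     (\<forall>i\<in>S. return_time_prob K i sums 1 \<and> summable (\<lambda>n. real n * return_time_prob K i n))"

text \<open>
  The jump law on the strip: $\phi(\ell, \ell'; d)$ is \<open>pmf (\<phi> \<ell>) (\<ell>', d)\<close>, so that \<open>\<phi> \<ell>\<close> is the
  joint law of $(U_{t+1}, V_{t+1} - V_t)$ given $U_t = \ell$, $V_t = x$, for any $x$.
\<close>

type_synonym jump_law = "nat \<Rightarrow> (nat \<times> int) pmf"

text \<open>
  The initial distribution is arbitrary. The Markov property is imposed for conditioning on
  histories of positive probability only, and jumps from a line of the strip stay in the strip.
\<close>

locale strip_chain = prob_space M
  for M :: "'w measure" and A :: "nat set" and \<phi> :: jump_law
    and U :: "nat \<Rightarrow> 'w \<Rightarrow> nat" and V :: "nat \<Rightarrow> 'w \<Rightarrow> int" +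
  assumes jumps_in_strip: "\<And>l. l \<in> A \<Longrightarrow> set_pmf (\<phi> l) \<subseteq> A \<times> UNIV"
    and U_measurable: "\<And>t. U t \<in> measurable M (count_space A)"
    and V_measurable: "\<And>t. V t \<in> measurable M (count_space UNIV)"
    and markov_property: "\<And>t u v l' d. (\<forall>s\<le>t. u s \<in> A) \<Longrightarrow> l' \<in> A \<Longrightarrow>
      \<P>(w in M. \<forall>s\<le>t. U s w = u s \<and> V s w = v s) > 0 \<Longrightarrow>
      \<P>(w in M. U (Suc t) w = l' \<and> V (Suc t) w = v t + d \<bar> \<forall>s\<le>t. U s w = u s \<and> V s w = v s)
        = pmf (\<phi> (u t)) (l', d)"

definition induced_chain :: "jump_law \<Rightarrow> nat \<Rightarrow> nat pmf" where
  "induced_chain \<phi> l = map_pmf fst (\<phi> l)"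

lemma pmf_induced_chain: "pmf (induced_chain \<phi> l) l' = (\<Sum>\<^sub>\<infinity>d\<in>UNIV. pmf (\<phi> l) (l', d))"
proof -
  have "pmf (induced_chain \<phi> l) l' = measure_pmf.prob (\<phi> l) (range (Pair l'))"
    unfolding induced_chain_def pmf_map by (rule arg_cong[where f = "measure_pmf.prob (\<phi> l)"]) auto
  also have "\<dots> = infsetsum (pmf (\<phi> l)) (range (Pair l'))"
    by (rule measure_pmf_conv_infsetsum)
  also have "\<dots> = infsum (pmf (\<phi> l)) (range (Pair l'))"
    by (rule infsetsum_infsum[OF pmf_abs_summable])
  also have "\<dots> = (\<Sum>\<^sub>\<infinity>d\<in>UNIV. pmf (\<phi> l) (l', d))"
    by (subst infsum_reindex) (auto simp: inj_on_def o_def)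
  finally show ?thesis .
qed

text \<open>
  Here \<open>max 0 d\<close> and \<open>max 0 (- d)\<close> are $d^+$ and $d^-$. The tail is a real number and the moments
  lie in \<open>[0, \<infinity>]\<close>; the conditional law given $U_t = \ell$, $V_t = z$ is the law \<open>\<phi> \<ell>\<close>, also
  when the conditioning event is null.
\<close>

definition tail_plus :: "jump_law \<Rightarrow> nat \<Rightarrow> real \<Rightarrow> real" where
  "tail_plus \<phi> l x = measure_pmf.prob (\<phi> l) {(l', d). max 0 (real_of_int d) > x}"

definition moment_plus :: "jump_law \<Rightarrow> nat \<Rightarrow> real \<Rightarrow> ennreal" where
  "moment_plus \<phi> l \<beta> = (\<integral>\<^sup>+ (l', d). ennreal (max 0 (real_of_int d) powr \<beta>) \<partial>measure_pmf (\<phi> l))"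

definition moment_minus :: "jump_law \<Rightarrow> nat \<Rightarrow> real \<Rightarrow> ennreal" where
  "moment_minus \<phi> l \<beta> = (\<integral>\<^sup>+ (l', d). ennreal (max 0 (- real_of_int d) powr \<beta>) \<partial>measure_pmf (\<phi> l))"

end

theory Submission
  imports Defs
begin

text \<open>
  Split the displacement \<open>V\<^sub>t - V\<^sub>0\<close> into the sum of the upward jumps, the rise, minus the sum of the
  downward jumps, the fall.  Only exponents are at stake, so every estimate below may lose a factor
  \<open>t\<^sup>\<epsilon>\<close>; this is what keeps the argument elementary.

  Upper bounds.  If \<open>p < \<alpha>\<close>, the \<open>p\<close>-th moments of the upward jumps are bounded uniformly over the
  lines: on line \<open>0\<close> by the tail assumption, elsewhere because \<open>p < \<beta>\<close>.  For \<open>p \<le> 1\<close> the function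
  \<open>x\<^sup>p\<close> is subadditive, and bounded \<open>p\<close>-th moments alone force a sum of \<open>t\<close> nonnegative terms to stay
  below \<open>t\<^sup>\<gamma>\<close> eventually, for each \<open>\<gamma> > 1 / p\<close> (\<open>AE_sum_eventually_le_powr\<close>).  Hence the rise is
  almost surely at most \<open>t\<^sup>\<gamma>\<close> for each \<open>\<gamma> > 1 / \<alpha>\<close>.  In the same way the fall is at most \<open>t\<^sup>\<gamma>\<close> for each
  \<open>\<gamma> > 1 / min \<beta> 1\<close>, which is of smaller order because \<open>min \<beta> 1 > \<alpha>\<close>.

  Lower bound.  A single jump from line \<open>0\<close> already makes the rise larger than \<open>t\<^sup>\<delta>\<close>, for each
  \<open>\<delta> < 1 / \<alpha>\<close>.  The expected hitting time of \<open>0\<close> is a Lyapunov function for the induced chain and shows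
  that, for each initial line, fewer than \<open>m\<close> visits to line \<open>0\<close> before time \<open>t\<close> have probability
  \<open>O((1 + m) / t)\<close> (\<open>prob_few_visits_le\<close>).  When there are \<open>m\<close> visits, all jumps from them stay below \<open>x\<close> with
  probability at most \<open>exp (- m T(x))\<close>, \<open>T\<close> being the tail of the heavy line
  (\<open>prob_many_visits_small_jumps_le\<close>).  With \<open>m = t\<^sup>\<gamma>\<close>, \<open>x = t\<^sup>\<delta>\<close> and \<open>\<delta>\<alpha> < \<gamma> < 1\<close> both probabilities are
  summable along \<open>t = 2\<^sup>n\<close>, so by Borel--Cantelli the large jump occurs before time \<open>t\<close> for all
  large \<open>t\<close>.

  The Markov property enters only through \<open>nn_integral_step\<close>, which integrates out one step of the
  chain given its past.
\<close>

section \<open>Countably valued random variables and their conditional laws\<close>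

lemma (in prob_space) distr_countable_eq_measure_pmf:
  fixes X :: "'a \<Rightarrow> 'b::countable"
  assumes [measurable]: "X \<in> measurable M (count_space UNIV)"
  obtains p where "distr M (count_space UNIV) X = measure_pmf p"
proof -
  let ?D = "distr M (count_space UNIV) X"
  interpret D: prob_space ?D by (rule prob_space_distr) measurable
  have "AE x in ?D. measure ?D {x} \<noteq> 0"
    by (subst D.AE_support_countable) (auto intro!: exI[of _ UNIV])
  then have "?D \<in> {M. prob_space M \<and> sets M = UNIV \<and> (AE x in M. measure M {x} \<noteq> 0)}"
    using D.prob_space_axioms by simp
  from Abs_pmf_inverse[OF this] show ?thesis by (intro that[of "Abs_pmf ?D"]) simp
qed

text \<open>
  If the conditional law of \<open>Z\<close> given \<open>X = x\<close> is the mass function \<open>\<kappa> x\<close>, then integrating out \<open>Z\<close>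
  first is legitimate.  Both sides are integrals against the same mass function on pairs, so it
  suffices to compare point masses.
\<close>

lemma (in prob_space) nn_integral_disintegrate:
  fixes X :: "'a \<Rightarrow> 'b::countable" and Z :: "'a \<Rightarrow> 'c::countable"
  assumes X[measurable]: "X \<in> measurable M (count_space UNIV)"
    and Z[measurable]: "Z \<in> measurable M (count_space UNIV)"
    and joint: "\<And>x z. prob {w\<in>space M. X w = x} > 0 \<Longrightarrow>
      prob {w\<in>space M. X w = x \<and> Z w = z} = prob {w\<in>space M. X w = x} * pmf (\<kappa> x) z"
  shows "(\<integral>\<^sup>+w. F (X w) (Z w) \<partial>M) = (\<integral>\<^sup>+w. (\<integral>\<^sup>+z. F (X w) z \<partial>\<kappa> (X w)) \<partial>M)"
proof -
  have XZ[measurable]: "(\<lambda>w. (X w, Z w)) \<in> measurable M (count_space UNIV)"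
    using measurable_Pair[OF X Z] by (simp add: pair_measure_countable)
  obtain p where p: "distr M (count_space UNIV) X = measure_pmf p"
    by (rule distr_countable_eq_measure_pmf[OF X])
  obtain q where q: "distr M (count_space UNIV) (\<lambda>w. (X w, Z w)) = measure_pmf q"
    by (rule distr_countable_eq_measure_pmf[OF XZ])
  have pmf_p: "pmf p x = prob {w\<in>space M. X w = x}" for x
    by (auto simp: pmf.rep_eq p[symmetric] measure_distr intro!: arg_cong[where f=prob])
  have pmf_q: "pmf q (x, z) = prob {w\<in>space M. X w = x \<and> Z w = z}" for x z
    by (auto simp: pmf.rep_eq q[symmetric] measure_distr intro!: arg_cong[where f=prob])
  have "q = bind_pmf p (\<lambda>x. map_pmf (Pair x) (\<kappa> x))"
  proof (rule pmf_eqI)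
    fix a :: "'b \<times> 'c"
    obtain x z where a: "a = (x, z)" by (cases a)
    have fibre: "pmf (map_pmf (Pair y) (\<kappa> y)) (x, z) = pmf (\<kappa> x) z * indicator {x} y" for y
    proof (cases "y = x")
      case True
      then show ?thesis by (simp add: pmf_map_inj' inj_on_def)
    next
      case False
      then have "(x, z) \<notin> set_pmf (map_pmf (Pair y) (\<kappa> y))" by auto
      then show ?thesis using False by (simp add: pmf_eq_0_set_pmf)
    qed
    have "pmf (bind_pmf p (\<lambda>x. map_pmf (Pair x) (\<kappa> x))) (x, z) = pmf (\<kappa> x) z * pmf p x"
      unfolding pmf_bind fibre by (simp add: measure_pmf_single)
    also have "\<dots> = pmf q (x, z)"
    proof (cases "prob {w\<in>space M. X w = x} > 0")
      case True
      then show ?thesis by (simp add: pmf_q pmf_p joint)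
    next
      case False
      then have "prob {w\<in>space M. X w = x} = 0" by (simp add: zero_less_measure_iff)
      moreover have "prob {w\<in>space M. X w = x \<and> Z w = z} \<le> prob {w\<in>space M. X w = x}"
        by (intro finite_measure_mono) auto
      ultimately show ?thesis by (simp add: pmf_q pmf_p measure_le_0_iff)
    qed
    finally show "pmf q a = pmf (bind_pmf p (\<lambda>x. map_pmf (Pair x) (\<kappa> x))) a"
      by (simp add: a)
  qed
  then have "(\<integral>\<^sup>+a. F (fst a) (snd a) \<partial>measure_pmf q) = (\<integral>\<^sup>+x. (\<integral>\<^sup>+z. F x z \<partial>\<kappa> x) \<partial>measure_pmf p)"
    by simp
  then show ?thesis
    by (simp add: p[symmetric] q[symmetric] nn_integral_distr)
qed

section \<open>Sums along powers of two\<close>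

lemma (in prob_space) AE_eventually_notin_geometric:
  fixes B :: "nat \<Rightarrow> 'a set" and c r :: real
  assumes "\<And>n. B n \<in> events" and "\<forall>\<^sub>F n in sequentially. prob (B n) \<le> c * r ^ n"
    and r: "0 \<le> r" "r < 1"
  shows "AE w in M. \<forall>\<^sub>F n in sequentially. w \<notin> B n"
proof -
  have "summable (\<lambda>n. prob (B n))"
  proof (rule summable_comparison_test_ev)
    show "summable (\<lambda>n. c * r ^ n)" using r by (intro summable_mult summable_geometric) auto
  qed (use assms in simp)
  from borel_cantelli_AE1[OF assms(1) _ this]
  have "AE w in M. \<forall>\<^sub>F n in sequentially. w \<in> space M - B n"
    by (simp add: emeasure_eq_measure)
  then show ?thesis by (rule AE_mp) (auto intro!: AE_I2 elim: eventually_mono)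
qed

text \<open>
  Transfers an eventual property of the powers of two to all large times, each of which lies in a
  unique block between consecutive powers.
\<close>

lemma eventually_dyadic_block:
  assumes "\<forall>\<^sub>F n in sequentially. P n"
  shows "\<forall>\<^sub>F t in sequentially. \<exists>n. P n \<and> 2 ^ n \<le> t \<and> t < (2::nat) ^ Suc n"
proof -
  obtain N where N: "\<And>n. n \<ge> N \<Longrightarrow> P n" using assms by (auto simp: eventually_sequentially)
  have "\<exists>n. P n \<and> 2 ^ n \<le> t \<and> t < 2 ^ Suc n" if t: "t \<ge> 2 ^ N" for t :: nat
  proof -
    have "t \<ge> 1" using t by (meson le_trans one_le_numeral one_le_power)
    then obtain n where n: "2 ^ n \<le> t" "t < 2 ^ (n + 1)" using ex_power_ivl1[of 2 t] by auto
    have "(2::nat) ^ N < 2 ^ (n + 1)" using t n by linarith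
    then have "N < n + 1" by (rule power_less_imp_less_exp[rotated]) simp
    then have "N \<le> n" by simp
    then show ?thesis using N n by auto
  qed
  then show ?thesis by (auto simp: eventually_sequentially)
qed

text \<open>
  Apply \<open>u \<le> u\<^sup>p\<close>, valid for \<open>0 \<le> u \<le> 1\<close>, to the two shares of \<open>a\<close> and \<open>b\<close> in their sum.
\<close>

lemma powr_add_le_add_powr:
  fixes a b p :: real
  assumes "0 \<le> a" "0 \<le> b" and p: "0 < p" "p \<le> 1"
  shows "(a + b) powr p \<le> a powr p + b powr p"
proof (cases "a + b = 0")
  case False
  then have s: "a + b > 0" using assms by linarith
  have frac: "u \<le> u powr p" if "0 \<le> u" "u \<le> 1" for u :: real
    using that p powr_mono'[of p 1 u] by (cases "u = 0") auto
  have "1 = a / (a + b) + b / (a + b)" using s by (simp add: add_divide_distrib[symmetric])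
  also have "\<dots> \<le> (a / (a + b)) powr p + (b / (a + b)) powr p"
    using assms s by (intro add_mono frac) auto
  also have "\<dots> = (a powr p + b powr p) / (a + b) powr p"
    using assms s by (simp add: powr_divide add_divide_distrib)
  finally show ?thesis using s by (simp add: field_simps)
qed (use assms in auto)

lemma powr_sum_le_sum_powr:
  fixes f :: "'i \<Rightarrow> real"
  assumes "\<And>i. i \<in> I \<Longrightarrow> 0 \<le> f i" and p: "0 < p" "p \<le> 1"
  shows "(\<Sum>i\<in>I. f i) powr p \<le> (\<Sum>i\<in>I. f i powr p)"
  using assms(1)
proof (induction I rule: infinite_finite_induct)
  case (insert x I)
  have "(f x + sum f I) powr p \<le> f x powr p + sum f I powr p"
    using insert p by (intro powr_add_le_add_powr sum_nonneg) auto
  then show ?case using insert by fastforce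
qed auto

text \<open>
  A law of large numbers for infinite means: since \<open>x \<mapsto> x\<^sup>p\<close> is subadditive, the \<open>p\<close>-th moment of
  the \<open>t\<close>-th partial sum is at most \<open>K t\<close>, so Markov's inequality makes it unlikely, by a factor
  geometric in \<open>n\<close>, that the sum at time \<open>2\<^sup>n\<close> exceeds \<open>2\<^sup>n\<^sup>\<gamma>\<close> when \<open>\<gamma> > 1 / p\<close>.  Monotonicity of the
  partial sums fills the gaps between the powers of two.
\<close>

lemma (in prob_space) AE_sum_eventually_le_powr:
  fixes y :: "nat \<Rightarrow> 'a \<Rightarrow> real"
  assumes [measurable]: "\<And>s. y s \<in> borel_measurable M" and nonneg: "\<And>s w. 0 \<le> y s w"
    and p: "0 < p" "p \<le> 1" and moment: "\<And>s. (\<integral>\<^sup>+w. ennreal (y s w powr p) \<partial>M) \<le> ennreal K"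
    and K: "0 \<le> K" and gamma: "\<gamma> * p > 1"
  shows "AE w in M. \<forall>\<^sub>F t in sequentially. (\<Sum>s<t. y s w) \<le> real t powr \<gamma>"
proof -
  define c where "c n = 2 powr (- (real n * \<gamma> * p))" for n :: nat
  define B where "B n = {w\<in>space M. 1 \<le> ennreal (c n) * ennreal (\<Sum>s<2 ^ Suc n. y s w powr p)}" for n
  have meas: "B n \<in> events" for n unfolding B_def by measurable
  have "prob (B n) \<le> (2 * K) * (2 powr (1 - \<gamma> * p)) ^ n" for n
  proof -
    have "emeasure M (B n) \<le> ennreal (c n) * (\<integral>\<^sup>+w. ennreal (\<Sum>s<2 ^ Suc n. y s w powr p) * indicator (space M) w \<partial>M)"
      unfolding B_def by (intro nn_integral_Markov_inequality) auto
    also have "(\<integral>\<^sup>+w. ennreal (\<Sum>s<2 ^ Suc n. y s w powr p) * indicator (space M) w \<partial>M)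
        = (\<integral>\<^sup>+w. (\<Sum>s<2 ^ Suc n. ennreal (y s w powr p)) \<partial>M)"
      by (intro nn_integral_cong) (simp add: sum_ennreal)
    also have "\<dots> = (\<Sum>s<2 ^ Suc n. (\<integral>\<^sup>+w. ennreal (y s w powr p) \<partial>M))"
      by (rule nn_integral_sum) measurable
    also have "\<dots> \<le> (\<Sum>s<(2::nat) ^ Suc n. ennreal K)" by (intro sum_mono moment)
    also have "\<dots> = ennreal (2 ^ Suc n * K)"
      using K by (simp add: ennreal_mult'' ennreal_of_nat_eq_real_of_nat[symmetric] flip: ennreal_power)
    finally have "emeasure M (B n) \<le> ennreal (c n) * ennreal (2 ^ Suc n * K)"
      by (simp add: mult_left_mono)
    then have "prob (B n) \<le> c n * (2 ^ Suc n * K)"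
      using K by (simp add: emeasure_eq_measure c_def flip: ennreal_mult)
    also have "\<dots> = (2 * K) * (2 powr (1 - \<gamma> * p)) ^ n"
      by (simp add: c_def powr_diff powr_minus field_simps flip: powr_realpow powr_powr powr_mult)
    finally show ?thesis .
  qed
  moreover have "2 powr (1 - \<gamma> * p) < (1::real)" using gamma by (simp add: powr_less_one)
  ultimately have "AE w in M. \<forall>\<^sub>F n in sequentially. w \<notin> B n"
    using meas by (intro AE_eventually_notin_geometric always_eventually) auto
  then show ?thesis
  proof (rule AE_mp, intro AE_I2 impI)
    fix w assume w: "w \<in> space M" and ev: "\<forall>\<^sub>F n in sequentially. w \<notin> B n"
    have gamma_pos: "\<gamma> > 0" using gamma p by (metis less_trans zero_less_mult_pos2 zero_less_one)
    have block: "(\<Sum>s<t. y s w) \<le> real t powr \<gamma>"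
      if n: "w \<notin> B n" and t: "2 ^ n \<le> t" "t < 2 ^ Suc n" for n t
    proof -
      have two_pow: "2 ^ n \<le> real t" using t(1) by (metis of_nat_le_iff of_nat_numeral of_nat_power)
      let ?S = "\<Sum>s<2 ^ Suc n. y s w"
      have S: "0 \<le> ?S" by (simp add: sum_nonneg nonneg)
      have "c n * (\<Sum>s<2 ^ Suc n. y s w powr p) < 1"
        using n w by (simp add: B_def c_def sum_nonneg not_le flip: ennreal_mult ennreal_1)
      then have "(\<Sum>s<2 ^ Suc n. y s w powr p) < (2 powr (real n * \<gamma>)) powr p"
        by (simp add: c_def powr_minus powr_powr field_simps)
      moreover have "?S powr p \<le> (\<Sum>s<2 ^ Suc n. y s w powr p)"
        by (rule powr_sum_le_sum_powr) (use nonneg p in auto)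
      ultimately have small: "?S powr p < (2 powr (real n * \<gamma>)) powr p" by linarith
      have "?S < 2 powr (real n * \<gamma>)"
      proof (rule ccontr)
        assume "\<not> ?S < 2 powr (real n * \<gamma>)"
        then have "(2 powr (real n * \<gamma>)) powr p \<le> ?S powr p" using p by (intro powr_mono2) auto
        with small show False by linarith
      qed
      also have "\<dots> = (2 ^ n) powr \<gamma>" by (simp add: powr_powr[symmetric] powr_realpow)
      also have "\<dots> \<le> real t powr \<gamma>"
        using two_pow gamma_pos by (intro powr_mono2) auto
      finally have "?S \<le> real t powr \<gamma>" by simp
      moreover have "(\<Sum>s<t. y s w) \<le> ?S" using t nonneg by (intro sum_mono2) auto
      ultimately show ?thesis by linarith
    qed
    show "\<forall>\<^sub>F t in sequentially. (\<Sum>s<t. y s w) \<le> real t powr \<gamma>"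
      by (rule eventually_mono[OF eventually_dyadic_block[OF ev]]) (use block in blast)
  qed
qed

section \<open>One step of the chain\<close>

context strip_chain
begin

lemma U_in_strip: "w \<in> space M \<Longrightarrow> U t w \<in> A"
  using measurable_space[OF U_measurable[of t]] by simp

lemma U_measurable_UNIV[measurable]: "U t \<in> measurable M (count_space UNIV)"
  using measurable_compose[OF U_measurable[of t], of "\<lambda>l. l" "count_space UNIV"] by simp

declare V_measurable[measurable]

text \<open>
  Histories are recorded as lists because these form a countable type, so that the past is a discrete
  random variable to which \<open>nn_integral_disintegrate\<close> applies.
\<close>

definition past :: "nat \<Rightarrow> 'w \<Rightarrow> (nat \<times> int) list" where
  "past t w = map (\<lambda>s. (U s w, V s w)) [0..<Suc t]"

definition step :: "nat \<Rightarrow> 'w \<Rightarrow> nat \<times> int" where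
  "step t w = (U (Suc t) w, V (Suc t) w - V t w)"

text \<open>
  The pointwise form of measurability with respect to the natural filtration, which on a countable
  state space amounts to being constant on each history.
\<close>

definition determined_by_past :: "nat \<Rightarrow> ('w \<Rightarrow> 'b) \<Rightarrow> bool" where
  "determined_by_past t G \<longleftrightarrow> (\<forall>w\<in>space M. \<forall>w'\<in>space M.
     (\<forall>s\<le>t. U s w = U s w' \<and> V s w = V s w') \<longrightarrow> G w = G w')"

lemma past_eq_iff: "past t w = p \<longleftrightarrow>
    length p = Suc t \<and> (\<forall>s\<le>t. U s w = fst (p ! s) \<and> V s w = snd (p ! s))"
  by (auto simp: past_def list_eq_iff_nth_eq prod_eq_iff less_Suc_eq_le simp del: upt_Suc)

lemma last_past: "last (past t w) = (U t w, V t w)"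
  by (simp add: past_def)

lemma past_measurable[measurable]: "past t \<in> measurable M (count_space UNIV)"
proof -
  have "past t -` {p} \<inter> space M \<in> events" for p
  proof -
    have "past t -` {p} \<inter> space M
        = {w\<in>space M. length p = Suc t \<and> (\<forall>s\<in>{..t}. U s w = fst (p ! s) \<and> V s w = snd (p ! s))}"
      using past_eq_iff[of t _ p] by auto
    also have "\<dots> \<in> events" by measurable
    finally show ?thesis .
  qed
  then show ?thesis by (simp add: measurable_count_space_eq2_countable)
qed

lemma step_measurable[measurable]: "step t \<in> measurable M (count_space UNIV)"
proof -
  have "(\<lambda>w. (U (Suc t) w, V (Suc t) w - V t w)) \<in> measurable M (count_space UNIV \<Otimes>\<^sub>M count_space UNIV)"
    by measurable
  then show ?thesis by (simp add: step_def[abs_def] pair_measure_countable)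
qed

lemma jump_measurable[measurable]: "(\<lambda>w. snd (step s w)) \<in> measurable M (count_space UNIV)"
  by (rule measurable_compose[OF step_measurable]) simp

text \<open>
  The Markov property as a statement about the discrete random variables \<open>past t\<close> and \<open>step t\<close>.  Steps
  that leave the strip are outside the scope of the defining property, but both sides vanish there.
\<close>

lemma prob_past_step:
  assumes pos: "prob {w\<in>space M. past t w = p} > 0"
  shows "prob {w\<in>space M. past t w = p \<and> step t w = z}
    = prob {w\<in>space M. past t w = p} * pmf (\<phi> (fst (last p))) z"
proof -
  obtain w0 where w0: "w0 \<in> space M" "past t w0 = p"
    using pos by (metis (mono_tags, lifting) Collect_empty_eq measure_empty order_less_irrefl)
  have len: "length p = Suc t" and p_nth: "\<And>s. s \<le> t \<Longrightarrow> p ! s = (U s w0, V s w0)"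
    using w0(2) by (auto simp: past_eq_iff prod_eq_iff)
  have last_p: "last p = (U t w0, V t w0)" using last_past[of t w0] w0(2) by simp
  define u v where "u s = U s w0" and "v s = V s w0" for s
  have ev: "{w\<in>space M. past t w = p} = {w\<in>space M. \<forall>s\<le>t. U s w = u s \<and> V s w = v s}"
    by (auto simp: past_eq_iff len p_nth u_def v_def)
  obtain l' d where z: "z = (l', d)" by (cases z)
  have ev': "{w\<in>space M. past t w = p \<and> step t w = z}
     = {w\<in>space M. (U (Suc t) w = l' \<and> V (Suc t) w = v t + d) \<and> (\<forall>s\<le>t. U s w = u s \<and> V s w = v s)}"
    by (auto simp: past_eq_iff len p_nth u_def v_def step_def z)
  show ?thesis
  proof (cases "l' \<in> A")
    case True
    have "\<P>(w in M. U (Suc t) w = l' \<and> V (Suc t) w = v t + d \<bar> \<forall>s\<le>t. U s w = u s \<and> V s w = v s)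
        = pmf (\<phi> (u t)) (l', d)"
      using pos U_in_strip[OF w0(1)] True by (intro markov_property) (auto simp: ev u_def)
    then show ?thesis
      using pos unfolding ev ev' cond_prob_def by (simp add: field_simps z last_p u_def)
  next
    case False
    have empty: "{w\<in>space M. past t w = p \<and> step t w = z} = {}"
      using U_in_strip[of _ "Suc t"] False by (auto simp: step_def z)
    have "pmf (\<phi> (fst (last p))) z = 0"
      using jumps_in_strip[of "U t w0"] U_in_strip[OF w0(1), of t] False
      by (auto simp: z last_p pmf_eq_0_set_pmf)
    then show ?thesis unfolding empty by simp
  qed
qed

lemma determined_by_past_factor:
  assumes "determined_by_past t G"
  shows "\<exists>g. \<forall>w\<in>space M. G w = g (past t w)"
proof (intro exI ballI)
  fix w assume w: "w \<in> space M"
  define w' where "w' = (SOME w'. w' \<in> space M \<and> past t w' = past t w)"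
  have w': "w' \<in> space M \<and> past t w' = past t w"
    unfolding w'_def by (rule someI[of _ w]) (simp add: w)
  then have "\<forall>s\<le>t. U s w = U s w' \<and> V s w = V s w'"
    by (auto simp: past_def less_Suc_eq_le simp del: upt_Suc)
  then have "G w = G w'" using assms w w' unfolding determined_by_past_def by blast
  then show "G w = (\<lambda>p. G (SOME w'. w' \<in> space M \<and> past t w' = p)) (past t w)"
    unfolding w'_def .
qed

text \<open>
  The Markov property in the only form used below: the next step may be averaged out under the
  jump law of the current line, in the presence of any weight that the past determines.
\<close>

lemma nn_integral_step:
  assumes "determined_by_past t G"
  shows "(\<integral>\<^sup>+w. G w * f (step t w) \<partial>M) = (\<integral>\<^sup>+w. G w * (\<integral>\<^sup>+z. f z \<partial>\<phi> (U t w)) \<partial>M)"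
proof -
  obtain g where g: "\<And>w. w \<in> space M \<Longrightarrow> G w = g (past t w)"
    using determined_by_past_factor[OF assms] by blast
  have "(\<integral>\<^sup>+w. g (past t w) * f (step t w) \<partial>M)
      = (\<integral>\<^sup>+w. (\<integral>\<^sup>+z. g (past t w) * f z \<partial>\<phi> (fst (last (past t w)))) \<partial>M)"
    by (rule nn_integral_disintegrate) (auto intro: prob_past_step)
  also have "(\<integral>\<^sup>+w. g (past t w) * f (step t w) \<partial>M) = (\<integral>\<^sup>+w. G w * f (step t w) \<partial>M)"
    by (intro nn_integral_cong) (simp add: g)
  also have "(\<integral>\<^sup>+w. (\<integral>\<^sup>+z. g (past t w) * f z \<partial>\<phi> (fst (last (past t w)))) \<partial>M)
      = (\<integral>\<^sup>+w. G w * (\<integral>\<^sup>+z. f z \<partial>\<phi> (U t w)) \<partial>M)"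
    by (intro nn_integral_cong) (simp add: g last_past nn_integral_cmult)
  finally show ?thesis .
qed

lemma nn_integral_step_le:
  assumes "\<And>l. l \<in> A \<Longrightarrow> (\<integral>\<^sup>+z. f z \<partial>\<phi> l) \<le> K"
  shows "(\<integral>\<^sup>+w. f (step t w) \<partial>M) \<le> K"
proof -
  have "(\<integral>\<^sup>+w. f (step t w) \<partial>M) = (\<integral>\<^sup>+w. (\<integral>\<^sup>+z. f z \<partial>\<phi> (U t w)) \<partial>M)"
    using nn_integral_step[of t "\<lambda>_. 1" f] by (simp add: determined_by_past_def)
  also have "\<dots> \<le> (\<integral>\<^sup>+w. K \<partial>M)"
    by (intro nn_integral_mono assms U_in_strip)
  finally show ?thesis by (simp add: emeasure_space_1)
qed

end

section \<open>The expected return time as a Lyapunov function\<close>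

lemma length_trajectory: "xs \<in> set_pmf (trajectory K n l) \<Longrightarrow> length xs = n"
  by (induction n arbitrary: l xs) auto

lemma trajectory_Suc: "trajectory K (Suc n) l = bind_pmf (K l) (\<lambda>j. map_pmf (Cons j) (trajectory K n j))"
  by (simp add: map_pmf_def)

lemma map_butlast_trajectory: "map_pmf butlast (trajectory K (Suc n) l) = trajectory K n l"
proof (induction n arbitrary: l)
  case (Suc n)
  have "map_pmf butlast (trajectory K (Suc (Suc n)) l)
      = bind_pmf (K l) (\<lambda>j. map_pmf (\<lambda>xs. butlast (j # xs)) (trajectory K (Suc n) j))"
    by (subst trajectory_Suc) (simp add: map_bind_pmf pmf.map_comp o_def del: trajectory.simps)
  also have "\<dots> = bind_pmf (K l) (\<lambda>j. map_pmf (\<lambda>xs. j # butlast xs) (trajectory K (Suc n) j))"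
    by (intro bind_pmf_cong refl map_pmf_cong) (auto dest!: length_trajectory simp del: trajectory.simps)
  also have "\<dots> = bind_pmf (K l) (\<lambda>j. map_pmf (Cons j) (map_pmf butlast (trajectory K (Suc n) j)))"
    by (simp add: pmf.map_comp o_def del: trajectory.simps)
  also have "\<dots> = trajectory K (Suc n) l"
    unfolding Suc.IH by (rule trajectory_Suc[symmetric])
  finally show ?case .
qed (simp add: map_bind_pmf bind_return_pmf)

definition avoid_prob :: "('s \<Rightarrow> 's pmf) \<Rightarrow> 's \<Rightarrow> nat \<Rightarrow> 's \<Rightarrow> real" where
  "avoid_prob K i n l = measure_pmf.prob (trajectory K n l) {xs. i \<notin> set xs}"

text \<open>
  The sum of the tail probabilities \<open>\<P>(\<tau> > n)\<close>, that is, the expectation, possibly infinite, of the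
  first time \<open>\<tau> \<ge> 1\<close> at which the chain started from \<open>l\<close> is in \<open>i\<close>.
\<close>

definition expected_return :: "('s \<Rightarrow> 's pmf) \<Rightarrow> 's \<Rightarrow> 's \<Rightarrow> ennreal" where
  "expected_return K i l = (\<Sum>n. ennreal (avoid_prob K i n l))"

lemma avoid_prob_0 [simp]: "avoid_prob K i 0 l = 1"
  by (simp add: avoid_prob_def)

text \<open>
  A path that avoids \<open>i\<close> for \<open>n\<close> steps either avoids it for one more step or returns to it exactly then;
  the law of the first \<open>n\<close> steps is the image of the law of \<open>n + 1\<close> steps under \<open>butlast\<close>.
\<close>

lemma avoid_prob_Suc_return: "avoid_prob K i n i = avoid_prob K i (Suc n) i + return_time_prob K i (Suc n)"
proof -
  let ?P = "trajectory K (Suc n) i"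
  have ne: "AE xs in measure_pmf ?P. xs \<noteq> []"
    by (auto simp: AE_measure_pmf_iff dest!: length_trajectory simp del: trajectory.simps)
  have "avoid_prob K i n i = measure_pmf.prob ?P {xs. i \<notin> set (butlast xs)}"
    unfolding avoid_prob_def by (subst map_butlast_trajectory[symmetric]) (simp add: vimage_def)
  also have "\<dots> = measure_pmf.prob ?P
      ({xs. i \<notin> set xs} \<union> {xs. xs \<noteq> [] \<and> last xs = i \<and> i \<notin> set (butlast xs)})"
  proof (rule measure_pmf.finite_measure_eq_AE)
    show "AE xs in measure_pmf ?P. (xs \<in> {xs. i \<notin> set (butlast xs)}) =
      (xs \<in> {xs. i \<notin> set xs} \<union> {xs. xs \<noteq> [] \<and> last xs = i \<and> i \<notin> set (butlast xs)})"
      using ne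
    proof (rule AE_mp, intro AE_I2 impI)
      fix xs :: "'a list" assume "xs \<noteq> []"
      then show "(xs \<in> {xs. i \<notin> set (butlast xs)}) =
      (xs \<in> {xs. i \<notin> set xs} \<union> {xs. xs \<noteq> [] \<and> last xs = i \<and> i \<notin> set (butlast xs)})"
        by (cases xs rule: rev_cases) auto
    qed
  qed auto
  also have "\<dots> = avoid_prob K i (Suc n) i + return_time_prob K i (Suc n)"
    unfolding avoid_prob_def return_time_prob_def
    by (rule measure_pmf.finite_measure_Union) auto
  finally show ?thesis .
qed

text \<open>
  Summation by parts turns the partial sums of \<open>\<P>(\<tau> > n)\<close> into those of the expectation of \<open>\<tau>\<close> plus
  a boundary term \<open>N \<P>(\<tau> > N)\<close>, which is at most the tail of that expectation.
\<close>

lemma expected_return_self_finite: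
  assumes sums: "return_time_prob K i sums 1"
    and mean: "summable (\<lambda>n. real n * return_time_prob K i n)"
  shows "expected_return K i i < \<infinity>"
proof -
  define f q where "f = return_time_prob K i" and "q n = avoid_prob K i n i" for n
  define S where "S = (\<Sum>n. real n * f n)"
  have f0: "f 0 = 0" and fnn: "f n \<ge> 0" for n by (auto simp: f_def return_time_prob_def)
  have rec: "q n = q (Suc n) + f (Suc n)" for n
    unfolding q_def f_def by (rule avoid_prob_Suc_return)
  have q: "q n = 1 - (\<Sum>k<Suc n. f k)" for n
  proof (induction n)
    case (Suc n)
    then show ?case using rec[of n] by simp
  qed (simp add: q_def f0)
  have meanf: "summable (\<lambda>n. real n * f n)" using mean by (simp add: f_def)
  have summ: "summable f" and f1: "suminf f = 1" using sums by (auto simp: f_def sums_iff)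
  have "real n * q n \<le> S" for n
  proof -
    have "q n = (\<Sum>k. f (k + Suc n))"
      unfolding q by (subst suminf_minus_initial_segment[OF summ]) (simp add: f1)
    then have "real n * q n = (\<Sum>k. real n * f (k + Suc n))"
      using summ by (simp add: suminf_mult summable_ignore_initial_segment del: add_Suc_right)
    also have "\<dots> \<le> (\<Sum>k. real (k + Suc n) * f (k + Suc n))"
      using summ meanf
      by (intro suminf_le mult_right_mono fnn summable_mult summable_ignore_initial_segment[of f]
          summable_ignore_initial_segment[of "\<lambda>n. real n * f n"]) auto
    also have "\<dots> = S - (\<Sum>k<Suc n. real k * f k)"
      unfolding S_def by (rule suminf_minus_initial_segment[OF meanf])
    also have "\<dots> \<le> S" by (simp add: sum_nonneg fnn del: sum.lessThan_Suc)
    finally show ?thesis .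
  qed
  moreover have "(\<Sum>n<N. q n) = real N * q N + (\<Sum>k<Suc N. real k * f k)" for N
  proof (induction N)
    case (Suc N)
    then show ?case using rec[of N] by (simp add: algebra_simps)
  qed simp
  moreover have "(\<Sum>k<Suc N. real k * f k) \<le> S" for N
    unfolding S_def by (rule sum_le_suminf[OF meanf]) (auto simp: fnn)
  ultimately have "(\<Sum>n<N. q n) \<le> S + S" for N by (metis add_mono)
  then have "summable q"
    by (intro summableI_nonneg_bounded[of q "S + S"]) (auto simp: q_def avoid_prob_def)
  moreover have "q n \<ge> 0" for n by (simp add: q_def avoid_prob_def)
  ultimately have "(\<Sum>n. ennreal (q n)) = ennreal (suminf q)" by (intro suminf_ennreal2)
  then show ?thesis by (simp add: expected_return_def q_def)
qed

lemma avoid_prob_Suc: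
  "ennreal (avoid_prob K i (Suc n) l) = (\<integral>\<^sup>+j. (if j = i then 0 else ennreal (avoid_prob K i n j)) \<partial>K l)"
proof -
  have "ennreal (avoid_prob K i (Suc n) l) = emeasure (trajectory K (Suc n) l) {xs. i \<notin> set xs}"
    by (simp add: avoid_prob_def measure_pmf.emeasure_eq_measure)
  also have "\<dots> = (\<integral>\<^sup>+j. emeasure (trajectory K n j) {xs. i \<notin> set (j # xs)} \<partial>K l)"
    unfolding trajectory_Suc emeasure_bind_pmf by (simp add: vimage_def)
  also have "\<dots> = (\<integral>\<^sup>+j. (if j = i then 0 else ennreal (avoid_prob K i n j)) \<partial>K l)"
    by (intro nn_integral_cong) (auto simp: avoid_prob_def measure_pmf.emeasure_eq_measure)
  finally show ?thesis .
qed

lemma expected_return_first_step: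
  "expected_return K i l = 1 + (\<integral>\<^sup>+j. (if j = i then 0 else expected_return K i j) \<partial>K l)"
proof -
  have "(\<integral>\<^sup>+j. (if j = i then 0 else expected_return K i j) \<partial>K l)
      = (\<integral>\<^sup>+j. (\<Sum>n. if j = i then 0 else ennreal (avoid_prob K i n j)) \<partial>K l)"
    by (intro nn_integral_cong) (auto simp: expected_return_def)
  also have "\<dots> = (\<Sum>n. ennreal (avoid_prob K i (Suc n) l))"
    by (subst nn_integral_suminf) (auto simp: avoid_prob_Suc)
  finally show ?thesis
    unfolding expected_return_def
    by (subst suminf_offset[of _ 1]) auto
qed

text \<open>
  The first-step equation has a finite left-hand side, so the summand of every transition of positive
  probability is finite.
\<close>

lemma expected_return_finite_step:
  assumes self: "expected_return K i i < \<infinity>"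
    and l: "expected_return K i l < \<infinity>" and j: "j \<in> set_pmf (K l)"
  shows "expected_return K i j < \<infinity>"
proof (cases "j = i")
  case False
  have "(\<integral>\<^sup>+j. (if j = i then 0 else expected_return K i j) \<partial>K l) \<noteq> \<infinity>"
    using l unfolding expected_return_first_step[of K i l] by auto
  then have "AE j in K l. (if j = i then 0 else expected_return K i j) \<noteq> \<infinity>"
    by (intro nn_integral_PInf_AE) auto
  with False j show ?thesis by (auto simp: AE_measure_pmf_iff less_top)
qed (use self in simp)

lemma expected_return_finite_trajectory:
  assumes self: "expected_return K i i < \<infinity>"
  shows "expected_return K i l < \<infinity> \<Longrightarrow> xs \<in> set_pmf (trajectory K n l)
    \<Longrightarrow> expected_return K i (last (l # xs)) < \<infinity>"
proof (induction n arbitrary: l xs)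
  case (Suc n)
  then obtain j ys where "j \<in> set_pmf (K l)" "ys \<in> set_pmf (trajectory K n j)" "xs = j # ys"
    by auto
  with Suc.IH[of j ys] expected_return_finite_step[OF self Suc.prems(1)] show ?case by simp
qed simp

text \<open>
  With \<open>h\<close> the expected hitting time of \<open>i\<close>, set to \<open>0\<close> at \<open>i\<close>, one step lowers \<open>h\<close> by exactly \<open>1\<close> in the
  mean, except from \<open>i\<close> itself.  Finiteness spreads from \<open>i\<close>, where it is positive recurrence, along the
  transitions of positive probability, and by irreducibility these reach every state.
\<close>

lemma positive_recurrent_Lyapunov:
  assumes "irreducible_chain S K" "positive_recurrent_chain S K" "i \<in> S"
  shows "\<exists>(h :: 's \<Rightarrow> ennreal) b. b < \<infinity> \<and> (\<forall>l\<in>S. h l < \<infinity>) \<and>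
    (\<forall>l. (\<integral>\<^sup>+j. h j \<partial>K l) + 1 \<le> h l + (if l = i then b else 0))"
proof (intro exI conjI ballI allI)
  show self: "expected_return K i i < \<infinity>"
    using assms by (intro expected_return_self_finite) (auto simp: positive_recurrent_chain_def)
  show "(if l = i then 0 else expected_return K i l) < \<infinity>" if "l \<in> S" for l
  proof -
    obtain n where "measure_pmf.prob (trajectory K n i) {xs. last (i # xs) = l} > 0"
      using assms \<open>l \<in> S\<close> unfolding irreducible_chain_def by blast
    then have "set_pmf (trajectory K n i) \<inter> {xs. last (i # xs) = l} \<noteq> {}"
      by (metis measure_pmf_zero_iff order_less_irrefl)
    then obtain xs where "xs \<in> set_pmf (trajectory K n i)" "last (i # xs) = l" by blast
    then show ?thesis using expected_return_finite_trajectory[OF self self, of xs n] by auto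
  qed
  show "(\<integral>\<^sup>+j. (if j = i then 0 else expected_return K i j) \<partial>K l) + 1
      \<le> (if l = i then 0 else expected_return K i l) + (if l = i then expected_return K i i else 0)" for l
    by (subst add.commute) (simp flip: expected_return_first_step)
qed

section \<open>Visits to the heavy line and its large jumps\<close>

context strip_chain
begin

definition visits :: "nat \<Rightarrow> 'w \<Rightarrow> nat" where
  "visits t w = (\<Sum>s<t. if U s w = 0 then 1 else 0)"

lemma visits_measurable[measurable]: "visits t \<in> measurable M (count_space UNIV)"
  unfolding visits_def[abs_def] by measurable

lemma visits_mono: "s \<le> t \<Longrightarrow> visits s w \<le> visits t w"
  unfolding visits_def by (rule sum_mono2) auto

lemma visits_cong: "(\<And>s. s < t \<Longrightarrow> U s w = U s w') \<Longrightarrow> visits t w = visits t w'"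
  unfolding visits_def by (rule sum.cong) auto

text \<open>
  Freeze the Lyapunov function once the heavy line has been visited \<open>m\<close> times: each earlier time
  step costs \<open>1\<close>, and each of the at most \<open>m\<close> visits before freezing refunds at most \<open>b\<close>.  The bound is
  restricted to a fixed initial line because \<open>h\<close> may fail to be integrable under the initial law.
\<close>

lemma prob_few_visits_le:
  fixes h :: "nat \<Rightarrow> ennreal" and b :: ennreal
  assumes drift: "\<And>l. (\<integral>\<^sup>+j. h j \<partial>induced_chain \<phi> l) + 1 \<le> h l + (if l = 0 then b else 0)"
  shows "of_nat t * emeasure M {w\<in>space M. U 0 w = l0 \<and> visits t w < m} \<le> h l0 + b * of_nat m"
proof -
  \<comment> \<open>\<open>I s\<close> marks the times before freezing, and \<open>J s\<close> those among them spent on the heavy line.\<close>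
  define I where "I s w = (if U 0 w = l0 \<and> visits s w < m then 1 else 0 :: ennreal)" for s w
  define J where "J s w = I s w * (if U s w = 0 then 1 else 0)" for s w
  have [measurable]: "I s \<in> borel_measurable M" "J s \<in> borel_measurable M" for s
    unfolding I_def[abs_def] J_def[abs_def] by measurable
  have past_I: "determined_by_past s (I s)" for s
    unfolding determined_by_past_def I_def
  proof (intro ballI impI)
    fix w w' assume eq: "\<forall>r\<le>s. U r w = U r w' \<and> V r w = V r w'"
    then have "visits s w = visits s w'" by (intro visits_cong) auto
    with eq show "(if U 0 w = l0 \<and> visits s w < m then 1 else 0 :: ennreal)
        = (if U 0 w' = l0 \<and> visits s w' < m then 1 else 0)" by simp
  qed
  have I_antimono: "I t w \<le> I s w" if "s \<le> t" for s t w
    using visits_mono[OF that, of w] by (auto simp: I_def)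
  have meas_h: "(\<lambda>w. h (U s w)) \<in> borel_measurable M" for s
    by (rule measurable_compose[OF U_measurable_UNIV]) simp
  have meas_drift: "(\<lambda>w. \<integral>\<^sup>+j. h j \<partial>induced_chain \<phi> (U s w)) \<in> borel_measurable M" for s
    by (rule measurable_compose[OF U_measurable_UNIV, where g = "\<lambda>l. \<integral>\<^sup>+j. h j \<partial>induced_chain \<phi> l"]) simp
  note [measurable] = meas_h meas_drift
  have J_step: "(\<integral>\<^sup>+w. I (Suc s) w * h (U (Suc s) w) \<partial>M) + (\<integral>\<^sup>+w. I s w \<partial>M)
      \<le> (\<integral>\<^sup>+w. I s w * h (U s w) \<partial>M) + b * (\<integral>\<^sup>+w. J s w \<partial>M)" for s
  proof -
    have "(\<integral>\<^sup>+w. I (Suc s) w * h (U (Suc s) w) \<partial>M) \<le> (\<integral>\<^sup>+w. I s w * h (fst (step s w)) \<partial>M)"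
      by (intro nn_integral_mono) (simp add: step_def mult_right_mono I_antimono)
    also have "\<dots> = (\<integral>\<^sup>+w. I s w * (\<integral>\<^sup>+j. h j \<partial>induced_chain \<phi> (U s w)) \<partial>M)"
      using nn_integral_step[OF past_I, of s "\<lambda>z. h (fst z)"] by (simp add: induced_chain_def)
    finally have "(\<integral>\<^sup>+w. I (Suc s) w * h (U (Suc s) w) \<partial>M) + (\<integral>\<^sup>+w. I s w \<partial>M)
        \<le> (\<integral>\<^sup>+w. I s w * (\<integral>\<^sup>+j. h j \<partial>induced_chain \<phi> (U s w)) \<partial>M) + (\<integral>\<^sup>+w. I s w \<partial>M)"
      by (rule add_right_mono)
    also have "\<dots> = (\<integral>\<^sup>+w. I s w * ((\<integral>\<^sup>+j. h j \<partial>induced_chain \<phi> (U s w)) + 1) \<partial>M)"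
      by (simp add: nn_integral_add[symmetric] distrib_left)
    also have "\<dots> \<le> (\<integral>\<^sup>+w. I s w * (h (U s w) + (if U s w = 0 then b else 0)) \<partial>M)"
      by (intro nn_integral_mono mult_left_mono drift) auto
    also have "\<dots> = (\<integral>\<^sup>+w. I s w * h (U s w) + b * J s w \<partial>M)"
      by (intro nn_integral_cong) (auto simp: J_def I_def)
    also have "\<dots> = (\<integral>\<^sup>+w. I s w * h (U s w) \<partial>M) + b * (\<integral>\<^sup>+w. J s w \<partial>M)"
      by (simp add: nn_integral_add nn_integral_cmult)
    finally show ?thesis .
  qed
  have sum_bound: "(\<integral>\<^sup>+w. I t w * h (U t w) \<partial>M) + (\<Sum>s<t. \<integral>\<^sup>+w. I s w \<partial>M)
      \<le> h l0 + b * (\<Sum>s<t. \<integral>\<^sup>+w. J s w \<partial>M)" for t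
  proof (induction t)
    case 0
    have "(\<integral>\<^sup>+w. I 0 w * h (U 0 w) \<partial>M) \<le> (\<integral>\<^sup>+w. h l0 \<partial>M)"
      by (intro nn_integral_mono) (auto simp: I_def)
    then show ?case by (simp add: emeasure_space_1)
  next
    case (Suc t)
    have "(\<integral>\<^sup>+w. I (Suc t) w * h (U (Suc t) w) \<partial>M) + (\<Sum>s<Suc t. \<integral>\<^sup>+w. I s w \<partial>M)
        = ((\<integral>\<^sup>+w. I (Suc t) w * h (U (Suc t) w) \<partial>M) + (\<integral>\<^sup>+w. I t w \<partial>M)) + (\<Sum>s<t. \<integral>\<^sup>+w. I s w \<partial>M)"
      by (simp add: ac_simps)
    also have "\<dots> \<le> ((\<integral>\<^sup>+w. I t w * h (U t w) \<partial>M) + b * (\<integral>\<^sup>+w. J t w \<partial>M)) + (\<Sum>s<t. \<integral>\<^sup>+w. I s w \<partial>M)"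
      by (rule add_right_mono[OF J_step])
    also have "\<dots> = ((\<integral>\<^sup>+w. I t w * h (U t w) \<partial>M) + (\<Sum>s<t. \<integral>\<^sup>+w. I s w \<partial>M)) + b * (\<integral>\<^sup>+w. J t w \<partial>M)"
      by (simp add: ac_simps)
    also have "\<dots> \<le> (h l0 + b * (\<Sum>s<t. \<integral>\<^sup>+w. J s w \<partial>M)) + b * (\<integral>\<^sup>+w. J t w \<partial>M)"
      by (rule add_right_mono[OF Suc.IH])
    also have "\<dots> = h l0 + b * (\<Sum>s<Suc t. \<integral>\<^sup>+w. J s w \<partial>M)"
      by (simp add: distrib_left ac_simps)
    finally show ?case .
  qed
  have J_le: "(\<Sum>s<t. J s w) \<le> of_nat m" for w
  proof -
    let ?c = "\<lambda>t. \<Sum>s<t. if U 0 w = l0 \<and> visits s w < m \<and> U s w = 0 then 1 else 0 :: nat"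
    have "?c t \<le> m \<and> ?c t \<le> visits t w" for t
      by (induction t) (auto simp: visits_def)
    then have "?c t \<le> m" by blast
    moreover have "(\<Sum>s<t. J s w) = of_nat (?c t)"
      unfolding of_nat_sum by (intro sum.cong) (auto simp: J_def I_def)
    ultimately show ?thesis by (simp only: of_nat_le_iff)
  qed
  have "of_nat t * emeasure M {w\<in>space M. U 0 w = l0 \<and> visits t w < m} = (\<Sum>s<t. \<integral>\<^sup>+w. I t w \<partial>M)"
  proof -
    have "(\<integral>\<^sup>+w. I t w \<partial>M) = (\<integral>\<^sup>+w. indicator {w\<in>space M. U 0 w = l0 \<and> visits t w < m} w \<partial>M)"
      by (intro nn_integral_cong) (auto simp: I_def indicator_def)
    then show ?thesis by simp
  qed
  also have "\<dots> \<le> (\<Sum>s<t. \<integral>\<^sup>+w. I s w \<partial>M)"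
    by (intro sum_mono nn_integral_mono I_antimono) auto
  also have "\<dots> \<le> (\<integral>\<^sup>+w. I t w * h (U t w) \<partial>M) + (\<Sum>s<t. \<integral>\<^sup>+w. I s w \<partial>M)" by simp
  also have "\<dots> \<le> h l0 + b * (\<Sum>s<t. \<integral>\<^sup>+w. J s w \<partial>M)" by (rule sum_bound)
  also have "(\<Sum>s<t. \<integral>\<^sup>+w. J s w \<partial>M) = (\<integral>\<^sup>+w. (\<Sum>s<t. J s w) \<partial>M)"
    by (rule nn_integral_sum[symmetric]) measurable
  also have "\<dots> \<le> (\<integral>\<^sup>+w. of_nat m \<partial>M)" by (intro nn_integral_mono J_le)
  finally show ?thesis by (simp add: emeasure_space_1 add_left_mono mult_left_mono)
qed

definition small_jumps :: "real \<Rightarrow> nat \<Rightarrow> 'w \<Rightarrow> bool" where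
  "small_jumps x t w \<longleftrightarrow> (\<forall>s<t. U s w = 0 \<longrightarrow> max 0 (real_of_int (snd (step s w))) \<le> x)"

lemma small_jumps_measurable[measurable]: "Measurable.pred M (small_jumps x t)"
proof -
  have "Measurable.pred M (\<lambda>w. \<forall>s\<in>{..<t}. U s w = 0 \<longrightarrow> max 0 (real_of_int (snd (step s w))) \<le> x)"
    by measurable
  then show ?thesis by (simp add: small_jumps_def[abs_def] lessThan_def)
qed

text \<open>
  A visit to the heavy line avoids a jump above \<open>x\<close> with probability \<open>1 - \<tau> \<le> exp (- \<tau>)\<close>, where
  \<open>\<tau> = tail_plus \<phi> 0 x\<close>; hence the product of \<open>exp \<tau>\<close> over the visits, killed at the first such jump,
  is a supermartingale.
\<close>

lemma prob_many_visits_small_jumps_le: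
  "prob {w\<in>space M. m \<le> visits t w \<and> small_jumps x t w} \<le> exp (- (tail_plus \<phi> 0 x * real m))"
proof -
  define \<tau> where "\<tau> = tail_plus \<phi> 0 x"
  have tau: "0 \<le> \<tau>" "\<tau> \<le> 1" by (auto simp: \<tau>_def tail_plus_def)
  define R where "R t w = (if small_jumps x t w then ennreal (exp (\<tau> * real (visits t w))) else 0)" for t w
  define f where "f z = ennreal (exp \<tau>) * indicator {z :: nat \<times> int. max 0 (real_of_int (snd z)) \<le> x} z" for z
  have [measurable]: "R t \<in> borel_measurable M" for t
    unfolding R_def[abs_def] by measurable
  have past_R: "determined_by_past t (R t)" for t
    unfolding determined_by_past_def
  proof (intro ballI impI)
    fix w w' assume eq: "\<forall>s\<le>t. U s w = U s w' \<and> V s w = V s w'"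
    then have v: "visits t w = visits t w'" by (intro visits_cong) auto
    have "snd (step s w) = snd (step s w')" if "s < t" for s
      using eq that by (simp add: step_def Suc_le_eq)
    with eq have "small_jumps x t w = small_jumps x t w'" by (auto simp: small_jumps_def)
    with v show "R t w = R t w'" by (simp add: R_def)
  qed
  have past_R0: "determined_by_past t (\<lambda>w. R t w * indicator {0} (U t w))" for t
    using past_R[of t] unfolding determined_by_past_def by (metis order_refl)
  have f_le: "(\<integral>\<^sup>+z. f z \<partial>\<phi> 0) \<le> 1"
  proof -
    have "measure_pmf.prob (\<phi> 0) {z. max 0 (real_of_int (snd z)) \<le> x} = 1 - \<tau>"
      unfolding \<tau>_def tail_plus_def
      by (subst measure_pmf.prob_compl[symmetric]) (auto intro!: arg_cong[where f="measure_pmf.prob (\<phi> 0)"])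
    then have "(\<integral>\<^sup>+z. f z \<partial>\<phi> 0) = ennreal (exp \<tau> * (1 - \<tau>))"
      using tau unfolding f_def
      by (simp add: nn_integral_cmult_indicator measure_pmf.emeasure_eq_measure ennreal_mult)
    also have "\<dots> \<le> ennreal (exp \<tau> * exp (- \<tau>))"
      using exp_ge_add_one_self[of "- \<tau>"] by (intro ennreal_leI mult_left_mono) auto
    finally show ?thesis by (simp add: exp_minus)
  qed
  have bound: "(\<integral>\<^sup>+w. R t w \<partial>M) \<le> 1" for t
  proof (induction t)
    case 0
    show ?case by (simp add: R_def small_jumps_def visits_def emeasure_space_1)
  next
    case (Suc t)
    have eq: "R (Suc t) w = R t w * indicator (- {0}) (U t w)
        + (R t w * indicator {0} (U t w)) * f (step t w)" for w
      by (auto simp: R_def f_def small_jumps_def less_Suc_eq visits_def indicator_def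
          distrib_left exp_add ennreal_mult mult.commute)
    have [measurable]: "(\<lambda>w. f (step t w)) \<in> borel_measurable M"
      by (rule measurable_compose[OF step_measurable]) simp
    have [measurable]: "(\<lambda>w. indicator B (U t w) :: ennreal) \<in> borel_measurable M" for B
      by (rule measurable_compose[OF U_measurable_UNIV]) simp
    have "(\<integral>\<^sup>+w. R (Suc t) w \<partial>M) = (\<integral>\<^sup>+w. R t w * indicator (- {0}) (U t w) \<partial>M)
        + (\<integral>\<^sup>+w. (R t w * indicator {0} (U t w)) * f (step t w) \<partial>M)"
      unfolding eq by (rule nn_integral_add) measurable
    also have "(\<integral>\<^sup>+w. (R t w * indicator {0} (U t w)) * f (step t w) \<partial>M)
        = (\<integral>\<^sup>+w. (R t w * indicator {0} (U t w)) * (\<integral>\<^sup>+z. f z \<partial>\<phi> (U t w)) \<partial>M)"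
      by (rule nn_integral_step[OF past_R0])
    also have "\<dots> \<le> (\<integral>\<^sup>+w. R t w * indicator {0} (U t w) \<partial>M)"
    proof (rule nn_integral_mono)
      fix w
      show "R t w * indicator {0} (U t w) * (\<integral>\<^sup>+z. f z \<partial>\<phi> (U t w)) \<le> R t w * indicator {0} (U t w)"
        using mult_left_mono[OF f_le, of "R t w"] by (cases "U t w = 0") auto
    qed
    also have "(\<integral>\<^sup>+w. R t w * indicator (- {0}) (U t w) \<partial>M) + (\<integral>\<^sup>+w. R t w * indicator {0} (U t w) \<partial>M)
        = (\<integral>\<^sup>+w. R t w \<partial>M)"
      by (subst nn_integral_add[symmetric]) (auto intro!: nn_integral_cong simp: indicator_def)
    finally show ?case using Suc.IH by (simp add: add_left_mono)
  qed
  let ?E = "{w\<in>space M. m \<le> visits t w \<and> small_jumps x t w}"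
  have "ennreal (exp (\<tau> * real m)) * emeasure M ?E = (\<integral>\<^sup>+w. ennreal (exp (\<tau> * real m)) * indicator ?E w \<partial>M)"
    by (rule nn_integral_cmult_indicator[symmetric]) measurable
  also have "\<dots> \<le> (\<integral>\<^sup>+w. R t w \<partial>M)"
    using tau by (intro nn_integral_mono) (auto simp: R_def indicator_def intro!: ennreal_leI mult_left_mono)
  also have "\<dots> \<le> 1" by (rule bound)
  finally have "exp (\<tau> * real m) * prob ?E \<le> 1"
    by (simp add: emeasure_eq_measure ennreal_le_1 flip: ennreal_mult)
  then show ?thesis
    by (simp add: exp_minus \<tau>_def[symmetric] field_simps)
qed

end

section \<open>Tails of regular logarithmic decay\<close>

lemma tail_le_powr:
  fixes T :: "real \<Rightarrow> real"
  assumes lim: "((\<lambda>x. ln (T x) / ln x) \<longlongrightarrow> - \<alpha>) at_top" and T: "\<And>x. T x \<ge> 0" and a: "a < \<alpha>"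
  shows "\<forall>\<^sub>F x in at_top. T x \<le> x powr - a"
proof -
  have less: "- \<alpha> < - a" using a by simp
  show ?thesis
    using order_tendstoD(2)[OF lim less] eventually_gt_at_top[of 1]
  proof eventually_elim
    case (elim x)
    then have *: "ln (T x) < - a * ln x" using a by (simp add: field_simps)
    show ?case
    proof (cases "T x = 0")
      case False
      then have "T x = exp (ln (T x))" using T[of x] by simp
      also have "\<dots> \<le> exp (- a * ln x)" using * by simp
      finally show ?thesis using elim by (simp add: powr_def)
    qed simp
  qed
qed

text \<open>
  Since \<open>ln 0 = 0\<close>, a strictly negative limit also guarantees that the tail never vanishes.
\<close>

lemma powr_le_tail:
  fixes T :: "real \<Rightarrow> real"
  assumes lim: "((\<lambda>x. ln (T x) / ln x) \<longlongrightarrow> - \<alpha>) at_top" and T: "\<And>x. T x \<ge> 0"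
    and \<alpha>: "0 < \<alpha>" "\<alpha> < a"
  shows "\<forall>\<^sub>F x in at_top. x powr - a \<le> T x"
proof -
  have "- a < - \<alpha>" "- \<alpha> < 0" using \<alpha> by auto
  from order_tendstoD(1)[OF lim this(1)] order_tendstoD(2)[OF lim this(2)] eventually_gt_at_top[of 1]
  show ?thesis
  proof eventually_elim
    case (elim x)
    then have "T x \<noteq> 0" by auto
    then have pos: "T x > 0" using T[of x] by simp
    have "- a * ln x < ln (T x)" using elim by (simp add: field_simps)
    then have "exp (- a * ln x) < T x" using pos by (metis exp_less_cancel_iff exp_ln)
    then show ?case using elim by (simp add: powr_def)
  qed
qed

lemma filterlim_two_powr:
  assumes "0 < c"
  shows "filterlim (\<lambda>n. 2 powr (c * real n)) at_top sequentially"
proof -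
  have "filterlim (\<lambda>n. exp (c * ln 2 * real n)) at_top sequentially"
    using assms by (intro filterlim_compose[OF exp_at_top] filterlim_real_sequentially
        filterlim_tendsto_pos_mult_at_top[OF tendsto_const]) auto
  then show ?thesis by (simp add: powr_def mult_ac)
qed

text \<open>
  On the layer where \<open>Y\<close> lies between \<open>2\<^sup>n\<close> and \<open>2\<^sup>n\<^sup>+\<^sup>1\<close> its \<open>p\<close>-th power is at most \<open>2\<^sup>(\<^sup>n\<^sup>+\<^sup>1\<^sup>)\<^sup>p\<close>, while the layer has
  probability at most of order \<open>2\<^sup>-\<^sup>n\<^sup>a\<close>; the resulting series is geometric.
\<close>

lemma (in prob_space) nn_integral_powr_finite:
  fixes Y :: "'a \<Rightarrow> real"
  assumes [measurable]: "Y \<in> borel_measurable M" and nonneg: "\<And>w. 0 \<le> Y w"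
    and tail: "\<forall>\<^sub>F x in at_top. prob {w\<in>space M. Y w > x} \<le> x powr - a" and p: "0 < p" "p < a"
  shows "(\<integral>\<^sup>+w. ennreal (Y w powr p) \<partial>M) < \<infinity>"
proof -
  define E where "E n = {w\<in>space M. Y w > 2 ^ n}" for n :: nat
  define g where "g n = 2 powr (real (Suc n) * p) * prob (E n)" for n
  have [measurable]: "E n \<in> events" for n unfolding E_def by measurable
  have term_le: "f n \<le> suminf f" for f :: "nat \<Rightarrow> ennreal" and n
    using sum_le_suminf[of f "{n}"] by simp
  have pointwise: "ennreal (Y w powr p) \<le> 1 + (\<Sum>n. ennreal (2 powr (real (Suc n) * p)) * indicator (E n) w)"
    if w: "w \<in> space M" for w
  proof (cases "Y w \<le> 1")
    case True
    then have "Y w powr p \<le> 1" using nonneg[of w] p by (simp add: powr_le1)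
    then have "ennreal (Y w powr p) \<le> 1" by (simp add: ennreal_le_1)
    then show ?thesis by (simp add: add_increasing2)
  next
    case False
    define n where "n = nat (\<lceil>log 2 (Y w)\<rceil> - 1)"
    have "0 < log 2 (Y w)" using False by simp
    then have n: "real n < log 2 (Y w)" "log 2 (Y w) \<le> real (Suc n)" unfolding n_def by linarith+
    have "2 ^ n < Y w" using n(1) False by (simp add: less_log_iff powr_realpow)
    then have "w \<in> E n" using w by (simp add: E_def)
    have "Y w \<le> 2 powr real (Suc n)" using n(2) False by (simp add: log_le_iff)
    then have "Y w powr p \<le> (2 powr real (Suc n)) powr p" using nonneg p by (intro powr_mono2) auto
    then have "ennreal (Y w powr p) \<le> ennreal (2 powr (real (Suc n) * p)) * indicator (E n) w"
      using \<open>w \<in> E n\<close> by (simp add: powr_powr ennreal_leI)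
    also have "\<dots> \<le> (\<Sum>n. ennreal (2 powr (real (Suc n) * p)) * indicator (E n) w)"
      by (rule term_le[of "\<lambda>n. ennreal (2 powr (real (Suc n) * p)) * indicator (E n) w"])
    finally show ?thesis by (simp add: add_increasing)
  qed
  have "filterlim (\<lambda>n. (2::real) ^ n) at_top sequentially"
    using filterlim_two_powr[of 1] by (simp add: powr_realpow)
  then have "\<forall>\<^sub>F n in sequentially. prob (E n) \<le> (2 ^ n) powr - a"
    unfolding E_def by (rule filterlim_iff[THEN iffD1, rule_format, OF _ tail])
  then have "\<forall>\<^sub>F n in sequentially. norm (g n) \<le> 2 powr p * (2 powr (p - a)) ^ n"
  proof eventually_elim
    case (elim n)
    then have "g n \<le> 2 powr (real (Suc n) * p) * (2 powr real n) powr - a"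
      unfolding g_def by (intro mult_left_mono) (auto simp: powr_realpow)
    also have "\<dots> = 2 powr p * (2 powr (p - a)) ^ n"
      by (simp add: powr_powr powr_realpow[symmetric] powr_add[symmetric] algebra_simps)
    finally show ?case by (simp add: g_def)
  qed
  moreover have "summable (\<lambda>n. 2 powr p * (2 powr (p - a)) ^ n)"
    using p by (intro summable_mult summable_geometric) (auto simp: powr_less_one)
  ultimately have "summable g" by (rule summable_comparison_test_ev)
  have "(\<integral>\<^sup>+w. ennreal (Y w powr p) \<partial>M)
      \<le> (\<integral>\<^sup>+w. 1 + (\<Sum>n. ennreal (2 powr (real (Suc n) * p)) * indicator (E n) w) \<partial>M)"
    by (intro nn_integral_mono pointwise)
  also have "\<dots> = 1 + (\<Sum>n. ennreal (2 powr (real (Suc n) * p)) * emeasure M (E n))"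
    by (simp add: nn_integral_add nn_integral_suminf nn_integral_cmult_indicator emeasure_space_1)
  also have "\<dots> = 1 + (\<Sum>n. ennreal (g n))"
    by (simp add: g_def emeasure_eq_measure ennreal_mult)
  also have "\<dots> = 1 + ennreal (suminf g)"
    using \<open>summable g\<close> by (subst suminf_ennreal2) (auto simp: g_def)
  also have "\<dots> < \<infinity>" by simp
  finally show ?thesis .
qed

section \<open>Comparison with powers of time\<close>

lemma eventually_affine_powr_le:
  fixes a c D E :: real
  assumes "a < c" "0 < c"
  shows "\<forall>\<^sub>F t in sequentially. D + E * real t powr a \<le> real t powr c"
proof -
  have lim: "(\<lambda>t. real t powr - e) \<longlonglongrightarrow> 0" if "e > 0" for e
    using tendsto_neg_powr[of "- e" real sequentially] that filterlim_real_sequentially by simp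
  have "(\<lambda>t. D * real t powr - c + E * real t powr - (c - a)) \<longlonglongrightarrow> D * 0 + E * 0"
    using assms by (intro tendsto_intros lim) auto
  then have "\<forall>\<^sub>F t in sequentially. D * real t powr - c + E * real t powr - (c - a) < 1"
    by (rule order_tendstoD) simp
  with eventually_gt_at_top[of 0] show ?thesis
  proof eventually_elim
    case (elim t)
    then have "(D * real t powr - c + E * real t powr - (c - a)) * real t powr c \<le> 1 * real t powr c"
      by (intro mult_right_mono) auto
    then show ?case using elim by (simp add: algebra_simps powr_add[symmetric])
  qed
qed

text \<open>
  Rational exponents suffice to squeeze the limit, so that almost sure bounds for each fixed
  exponent can be combined into one event of probability \<open>1\<close>.  Lower bounds are asked for only near
  \<open>L\<close>, above some \<open>K\<close>; they also make \<open>v\<close> eventually positive.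
\<close>

lemma log_ratio_tendstoI:
  fixes v :: "nat \<Rightarrow> real"
  assumes "K < L"
    and lower: "\<And>q::rat. K < of_rat q \<Longrightarrow> of_rat q < L \<Longrightarrow> \<forall>\<^sub>F t in sequentially. real t powr of_rat q \<le> v t"
    and upper: "\<And>q::rat. L < of_rat q \<Longrightarrow> \<forall>\<^sub>F t in sequentially. v t \<le> real t powr of_rat q"
  shows "(\<lambda>t. ln (v t) / ln (real t)) \<longlonglongrightarrow> L"
proof (rule order_tendstoI)
  fix a assume "a < L"
  then obtain q where q: "max a K < of_rat q" "of_rat q < L"
    using of_rat_dense[of "max a K" L] \<open>K < L\<close> by auto
  then have "\<forall>\<^sub>F t in sequentially. real t powr of_rat q \<le> v t" by (intro lower) auto
  with eventually_gt_at_top[of 1] show "\<forall>\<^sub>F t in sequentially. a < ln (v t) / ln (real t)"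
  proof eventually_elim
    case (elim t)
    then have "ln (real t powr of_rat q) \<le> ln (v t)"
      by (intro ln_mono) auto
    then have "of_rat q \<le> ln (v t) / ln (real t)" using elim by (simp add: field_simps)
    with q show ?case by simp
  qed
next
  fix a assume "L < a"
  then obtain q where q: "L < of_rat q" "of_rat q < a" using of_rat_dense[of L a] by auto
  obtain q' where q': "K < of_rat q'" "of_rat q' < L" using of_rat_dense[of K L] \<open>K < L\<close> by auto
  from eventually_gt_at_top[of 1] lower[OF q'] upper[OF q(1)]
  show "\<forall>\<^sub>F t in sequentially. ln (v t) / ln (real t) < a"
  proof eventually_elim
    case (elim t)
    have "0 < real t powr of_rat q'" using elim by simp
    then have "0 < v t" using elim by linarith
    then have "ln (v t) \<le> ln (real t powr of_rat q)" using elim by (intro ln_mono) auto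
    then have "ln (v t) / ln (real t) \<le> of_rat q" using elim by (simp add: field_simps)
    with q show ?case by simp
  qed
qed

section \<open>Growth of the upward and downward displacements\<close>

context strip_chain
begin

definition rise :: "nat \<Rightarrow> 'w \<Rightarrow> real" where
  "rise t w = (\<Sum>s<t. max 0 (real_of_int (snd (step s w))))"

definition fall :: "nat \<Rightarrow> 'w \<Rightarrow> real" where
  "fall t w = (\<Sum>s<t. max 0 (- real_of_int (snd (step s w))))"

lemma V_eq_rise_fall: "real_of_int (V t w) = real_of_int (V 0 w) + rise t w - fall t w"
  by (induction t) (auto simp: rise_def fall_def step_def max_def)

lemma AE_rise_le_powr:
  assumes moment: "\<And>l. l \<in> A \<Longrightarrow> moment_plus \<phi> l p \<le> K" and K: "K < \<infinity>"
    and p: "0 < p" "p \<le> 1" and gamma: "\<gamma> * p > 1"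
  shows "AE w in M. \<forall>\<^sub>F t in sequentially. rise t w \<le> real t powr \<gamma>"
  unfolding rise_def
proof (rule AE_sum_eventually_le_powr[where K = "enn2real K" and p = p])
  show "(\<integral>\<^sup>+w. ennreal (max 0 (real_of_int (snd (step s w))) powr p) \<partial>M) \<le> ennreal (enn2real K)" for s
    using nn_integral_step_le[of "\<lambda>z. ennreal (max 0 (real_of_int (snd z)) powr p)" K s] moment K
    by (simp add: moment_plus_def case_prod_unfold)
qed (use p gamma in auto)

lemma AE_fall_le_powr:
  assumes moment: "\<And>l. l \<in> A \<Longrightarrow> moment_minus \<phi> l p \<le> K" and K: "K < \<infinity>"
    and p: "0 < p" "p \<le> 1" and gamma: "\<gamma> * p > 1"
  shows "AE w in M. \<forall>\<^sub>F t in sequentially. fall t w \<le> real t powr \<gamma>"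
  unfolding fall_def
proof (rule AE_sum_eventually_le_powr[where K = "enn2real K" and p = p])
  show "(\<integral>\<^sup>+w. ennreal (max 0 (- real_of_int (snd (step s w))) powr p) \<partial>M) \<le> ennreal (enn2real K)" for s
    using nn_integral_step_le[of "\<lambda>z. ennreal (max 0 (- real_of_int (snd z)) powr p)" K s] moment K
    by (simp add: moment_minus_def case_prod_unfold)
qed (use p gamma in auto)

text \<open>
  By time \<open>2\<^sup>n\<close> the heavy line has been visited at least \<open>m = 2\<^sup>\<gamma>\<^sup>n\<close> times, and one of the jumps from it
  exceeds \<open>x = 2\<^sup>\<delta>\<^sup>(\<^sup>n\<^sup>+\<^sup>1\<^sup>)\<close>.  The first may fail with probability of order \<open>m / 2\<^sup>n\<close>, the second with
  probability at most \<open>exp (- m x\<^sup>-\<^sup>a)\<close>; the choice \<open>\<delta>a < \<gamma> < 1\<close> makes both geometrically small.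
\<close>

lemma AE_rise_ge_powr_from:
  fixes h :: "nat \<Rightarrow> ennreal" and b :: ennreal
  assumes drift: "\<And>l. (\<integral>\<^sup>+j. h j \<partial>induced_chain \<phi> l) + 1 \<le> h l + (if l = 0 then b else 0)"
    and b: "b < \<infinity>" and h: "h l0 < \<infinity>"
    and tail: "\<forall>\<^sub>F x in at_top. x powr - a \<le> tail_plus \<phi> 0 x"
    and a: "0 < a" and delta: "0 < \<delta>" "\<delta> * a < 1"
  shows "AE w in M. U 0 w = l0 \<longrightarrow> (\<forall>\<^sub>F t in sequentially. real t powr \<delta> \<le> rise t w)"
proof -
  obtain \<gamma> where gamma: "\<delta> * a < \<gamma>" "\<gamma> < 1" using dense[OF delta(2)] by blast
  have gamma_pos: "0 < \<gamma>" using gamma(1) delta(1) a by (meson less_trans mult_pos_pos)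
  define m where "m n = nat \<lceil>2 powr (\<gamma> * real n)\<rceil>" for n :: nat
  \<comment> \<open>With \<open>Suc n\<close>, a jump above \<open>x n\<close> before time \<open>2 ^ n\<close> exceeds \<open>t powr \<delta>\<close> throughout the next block.\<close>
  define x where "x n = 2 powr (\<delta> * real (Suc n))" for n :: nat
  define B where "B n = {w\<in>space M. U 0 w = l0 \<and> small_jumps (x n) (2 ^ n) w}" for n :: nat
  define H b' where "H = enn2real (h l0)" and "b' = enn2real b"
  have Hb: "h l0 = ennreal H" "b = ennreal b'" "0 \<le> H" "0 \<le> b'"
    using h b by (auto simp: H_def b'_def)
  have m_ge: "2 powr (\<gamma> * real n) \<le> real (m n)" for n unfolding m_def by linarith
  have m_le: "real (m n) \<le> 2 * 2 powr (\<gamma> * real n)" for n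
  proof -
    have "real (m n) = of_int \<lceil>2 powr (\<gamma> * real n)\<rceil>" by (simp add: m_def)
    then have "real (m n) \<le> 2 powr (\<gamma> * real n) + 1" by linarith
    moreover have "1 \<le> (2::real) powr (\<gamma> * real n)" using gamma_pos by (simp add: ge_one_powr_ge_zero)
    ultimately show ?thesis by linarith
  qed
  define r where "r = (2::real) powr (max (\<gamma> - 1) (\<delta> * a - \<gamma>))"
  have few: "prob {w\<in>space M. U 0 w = l0 \<and> visits (2 ^ n) w < m n} \<le> (H + 2 * b') * r ^ n" for n
  proof -
    let ?E = "{w\<in>space M. U 0 w = l0 \<and> visits (2 ^ n) w < m n}"
    have "of_nat (2 ^ n) * emeasure M ?E \<le> h l0 + b * of_nat (m n)"
      by (rule prob_few_visits_le[OF drift])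
    then have "ennreal (2 ^ n * prob ?E) \<le> ennreal (H + b' * real (m n))"
      using Hb by (simp add: emeasure_eq_measure ennreal_mult ennreal_plus ennreal_of_nat_eq_real_of_nat
          flip: ennreal_power)
    then have "2 ^ n * prob ?E \<le> H + b' * real (m n)" using Hb by (subst (asm) ennreal_le_iff) auto
    also have "\<dots> \<le> H * 2 powr (\<gamma> * real n) + b' * (2 * 2 powr (\<gamma> * real n))"
    proof (rule add_mono)
      have "1 \<le> (2::real) powr (\<gamma> * real n)" using gamma_pos by (simp add: ge_one_powr_ge_zero)
      then show "H \<le> H * 2 powr (\<gamma> * real n)" using Hb(3) mult_left_mono by fastforce
      show "b' * real (m n) \<le> b' * (2 * 2 powr (\<gamma> * real n))" using Hb(4) m_le by (intro mult_left_mono)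
    qed
    finally have "prob ?E \<le> (H + 2 * b') * (2 powr (\<gamma> * real n) / 2 ^ n)"
      by (simp add: field_simps)
    also have "2 powr (\<gamma> * real n) / 2 ^ n = (2 powr (\<gamma> - 1)) ^ n"
      by (simp add: powr_realpow[symmetric] powr_powr powr_diff[symmetric] algebra_simps)
    also have "(H + 2 * b') * (2 powr (\<gamma> - 1)) ^ n \<le> (H + 2 * b') * r ^ n"
      using Hb by (intro mult_left_mono power_mono) (auto simp: r_def)
    finally show ?thesis .
  qed
  have "filterlim x at_top sequentially"
    using filterlim_two_powr[OF delta(1)]
    unfolding x_def by (subst filterlim_sequentially_Suc[of "\<lambda>n. 2 powr (\<delta> * real n)"])
  then have "\<forall>\<^sub>F n in sequentially. x n powr - a \<le> tail_plus \<phi> 0 (x n)"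
    by (rule filterlim_iff[THEN iffD1, rule_format, OF _ tail])
  then have "\<forall>\<^sub>F n in sequentially. prob (B n) \<le> (H + 2 * b' + 2 powr (\<delta> * a)) * r ^ n"
  proof eventually_elim
    case (elim n)
    let ?F = "{w\<in>space M. m n \<le> visits (2 ^ n) w \<and> small_jumps (x n) (2 ^ n) w}"
    let ?y = "2 powr (\<gamma> * real n - \<delta> * a * real (Suc n))"
    have "?y = x n powr - a * 2 powr (\<gamma> * real n)"
      by (simp add: x_def powr_powr powr_add[symmetric] algebra_simps)
    also have "\<dots> \<le> tail_plus \<phi> 0 (x n) * real (m n)"
      using elim m_ge by (intro mult_mono) (auto simp: tail_plus_def)
    finally have y: "?y \<le> tail_plus \<phi> 0 (x n) * real (m n)" .
    have "prob ?F \<le> exp (- (tail_plus \<phi> 0 (x n) * real (m n)))" by (rule prob_many_visits_small_jumps_le)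
    also have "\<dots> \<le> exp (- ?y)" using y by simp
    \<comment> \<open>This crude bound leaves a geometric sequence.\<close>
    also have "\<dots> \<le> 1 / ?y"
    proof -
      have "?y \<le> exp ?y" using exp_ge_add_one_self[of ?y] by linarith
      then show ?thesis by (simp add: exp_minus field_simps)
    qed
    also have "\<dots> = 2 powr (\<delta> * a) * (2 powr (\<delta> * a - \<gamma>)) ^ n"
      by (simp add: powr_realpow[symmetric] powr_powr powr_minus_divide[symmetric] powr_add[symmetric] algebra_simps)
    also have "\<dots> \<le> 2 powr (\<delta> * a) * r ^ n"
      by (intro mult_left_mono power_mono) (auto simp: r_def)
    finally have many: "prob ?F \<le> 2 powr (\<delta> * a) * r ^ n" .
    have "prob (B n) \<le> prob ({w\<in>space M. U 0 w = l0 \<and> visits (2 ^ n) w < m n} \<union> ?F)"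
      by (intro finite_measure_mono) (auto simp: B_def)
    also have "\<dots> \<le> prob {w\<in>space M. U 0 w = l0 \<and> visits (2 ^ n) w < m n} + prob ?F"
      by (intro measure_Un_le) measurable
    finally show ?case using few[of n] many by (simp add: algebra_simps)
  qed
  moreover have "B n \<in> events" for n unfolding B_def by measurable
  moreover have "0 \<le> r" "r < 1" using gamma by (auto simp: r_def powr_less_one)
  ultimately have "AE w in M. \<forall>\<^sub>F n in sequentially. w \<notin> B n"
    by (intro AE_eventually_notin_geometric)
  then show ?thesis
  proof (rule AE_mp, intro AE_I2 impI)
    fix w assume w: "w \<in> space M" "U 0 w = l0" and ev: "\<forall>\<^sub>F n in sequentially. w \<notin> B n"
    have block: "real t powr \<delta> \<le> rise t w" if n: "w \<notin> B n" and t: "2 ^ n \<le> t" "t < 2 ^ Suc n" for n t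
    proof -
      obtain s where s: "s < 2 ^ n" "x n < max 0 (real_of_int (snd (step s w)))"
        using n w by (auto simp: B_def small_jumps_def not_le)
      have "real t \<le> 2 ^ Suc n" using t(2) by (metis less_imp_le of_nat_le_iff of_nat_numeral of_nat_power)
      then have "real t powr \<delta> \<le> (2 ^ Suc n) powr \<delta>" using delta by (intro powr_mono2) auto
      also have "\<dots> = x n" unfolding x_def by (subst powr_realpow[symmetric]) (simp_all add: powr_powr mult.commute)
      also have "\<dots> \<le> max 0 (real_of_int (snd (step s w)))" using s(2) by simp
      also have "\<dots> \<le> rise t w"
        unfolding rise_def using s(1) t(1) by (intro member_le_sum) auto
      finally show ?thesis .
    qed
    show "\<forall>\<^sub>F t in sequentially. real t powr \<delta> \<le> rise t w"
      by (rule eventually_mono[OF eventually_dyadic_block[OF ev]]) (use block in blast)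
  qed
qed

end

section \<open>The growth exponent of the second coordinate\<close>

text \<open>
  The positive part of an integer is \<open>0\<close> or at least \<open>1\<close>, so its powers increase with the exponent.
\<close>

lemma powr_mono_exponent_int:
  fixes d :: int
  assumes "0 < p" "p \<le> q"
  shows "max 0 (real_of_int d) powr p \<le> max 0 (real_of_int d) powr q"
proof (cases "d \<le> 0")
  case False
  then have "1 \<le> max 0 (real_of_int d)" by linarith
  then show ?thesis using assms by (intro powr_mono) auto
qed (simp add: max_absorb1)

lemma moment_plus_mono: "0 < p \<Longrightarrow> p \<le> q \<Longrightarrow> moment_plus \<phi> l p \<le> moment_plus \<phi> l q"
  unfolding moment_plus_def case_prod_unfold
  by (intro nn_integral_mono ennreal_leI powr_mono_exponent_int)

lemma moment_minus_mono: "0 < p \<Longrightarrow> p \<le> q \<Longrightarrow> moment_minus \<phi> l p \<le> moment_minus \<phi> l q"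
  unfolding moment_minus_def case_prod_unfold
  by (intro nn_integral_mono ennreal_leI) (use powr_mono_exponent_int[of p q "- _"] in simp)

lemma moment_plus_finite_of_tail:
  assumes lim: "((\<lambda>x. ln (tail_plus \<phi> l x) / ln x) \<longlongrightarrow> - \<alpha>) at_top" and p: "0 < p" "p < \<alpha>"
  shows "moment_plus \<phi> l p < \<infinity>"
proof -
  obtain a where a: "p < a" "a < \<alpha>" using dense[OF p(2)] by blast
  have "\<forall>\<^sub>F x in at_top. tail_plus \<phi> l x \<le> x powr - a"
    by (rule tail_le_powr[OF lim _ a(2)]) (simp add: tail_plus_def)
  then show ?thesis
    unfolding moment_plus_def case_prod_unfold tail_plus_def
    by (intro measure_pmf.nn_integral_powr_finite[where a = a]) (use p a in auto)
qed

theorem theorem3p1: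
  fixes M :: "'w measure" and A :: "nat set" and \<phi> :: jump_law
    and U :: "nat \<Rightarrow> 'w \<Rightarrow> nat" and V :: "nat \<Rightarrow> 'w \<Rightarrow> int"
    and \<alpha> \<beta> :: real and C :: ennreal
  assumes strip: "(\<exists>k\<ge>1. A = {..<k}) \<or> A = UNIV"
    and chain: "strip_chain M A \<phi> U V"
    and irred: "irreducible_chain A (induced_chain \<phi>)"
    and pos_rec: "positive_recurrent_chain A (induced_chain \<phi>)"
    and alpha: "0 < \<alpha>" "\<alpha> < 1"
    and beta: "\<beta> > \<alpha>"
    and C_finite: "C < \<infinity>"
    and neg_moments: "\<And>l. l \<in> A \<Longrightarrow> moment_minus \<phi> l \<beta> \<le> C"
    and heavy_line: "((\<lambda>x. ln (tail_plus \<phi> 0 x) / ln x) \<longlongrightarrow> - \<alpha>) at_top"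
    and pos_moments: "\<And>l. l \<in> A \<Longrightarrow> l \<noteq> 0 \<Longrightarrow> moment_plus \<phi> l \<beta> \<le> C"
  shows "(AE w in M. filterlim (\<lambda>t. V t w) at_top sequentially) \<and>
    (AE w in M. (\<lambda>t. ln (real_of_int (V t w)) / ln (real t)) \<longlonglongrightarrow> 1 / \<alpha>)"
proof -
  interpret strip_chain M A \<phi> U V by (rule chain)
  \<comment> \<open>The moment order is capped at \<open>1\<close> for the sake of subadditivity; as \<open>\<alpha> < 1\<close>, it stays above \<open>\<alpha>\<close>.\<close>
  define \<beta>' where "\<beta>' = min \<beta> 1"
  have beta': "\<alpha> < \<beta>'" "\<beta>' \<le> \<beta>" "\<beta>' \<le> 1" "0 < \<beta>'" using alpha beta by (auto simp: \<beta>'_def)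
  have rates: "0 < 1 / \<beta>'" "1 / \<beta>' < 1 / \<alpha>" using alpha beta' by (auto simp: field_simps)
  have "0 \<in> A" using strip by auto
  obtain h :: "nat \<Rightarrow> ennreal" and b where b: "b < \<infinity>" and h: "\<forall>l\<in>A. h l < \<infinity>"
    and drift: "\<forall>l. (\<integral>\<^sup>+j. h j \<partial>induced_chain \<phi> l) + 1 \<le> h l + (if l = 0 then b else 0)"
    using positive_recurrent_Lyapunov[OF irred pos_rec \<open>0 \<in> A\<close>] by blast

  have rise_upper: "AE w in M. \<forall>\<^sub>F t in sequentially. rise t w \<le> real t powr \<gamma>" if gamma: "1 / \<alpha> < \<gamma>" for \<gamma>
  proof -
    have "0 < \<gamma>" using gamma alpha by (meson less_trans zero_less_divide_1_iff)
    then have "1 / \<gamma> < \<alpha>" using gamma alpha by (simp add: field_simps)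
    then obtain p where p: "1 / \<gamma> < p" "p < \<alpha>" using dense by blast
    have "0 < p" using p(1) \<open>0 < \<gamma>\<close> by (meson less_trans zero_less_divide_1_iff)
    have "moment_plus \<phi> l p \<le> max C (moment_plus \<phi> 0 p)" if l: "l \<in> A" for l
    proof (cases "l = 0")
      case False
      have "moment_plus \<phi> l p \<le> moment_plus \<phi> l \<beta>"
        using \<open>0 < p\<close> p beta by (intro moment_plus_mono) auto
      also have "\<dots> \<le> C" by (rule pos_moments[OF l False])
      finally show ?thesis by (simp add: le_max_iff_disj)
    qed simp
    moreover have "max C (moment_plus \<phi> 0 p) < \<infinity>"
      using C_finite moment_plus_finite_of_tail[OF heavy_line \<open>0 < p\<close> p(2)] by simp
    moreover have "\<gamma> * p > 1" using p(1) \<open>0 < \<gamma>\<close> by (simp add: field_simps)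
    ultimately show ?thesis using \<open>0 < p\<close> p alpha by (intro AE_rise_le_powr) auto
  qed

  have fall_upper: "AE w in M. \<forall>\<^sub>F t in sequentially. fall t w \<le> real t powr \<gamma>" if gamma: "1 / \<beta>' < \<gamma>" for \<gamma>
  proof (rule AE_fall_le_powr)
    show "moment_minus \<phi> l \<beta>' \<le> C" if "l \<in> A" for l
      using moment_minus_mono[OF beta'(4,2)] neg_moments[OF that] by (rule order_trans)
    show "1 < \<gamma> * \<beta>'" using gamma beta' by (simp add: field_simps)
  qed (use C_finite beta' in auto)

  have rise_lower: "AE w in M. \<forall>\<^sub>F t in sequentially. real t powr \<delta> \<le> rise t w"
    if delta: "0 < \<delta>" "\<delta> < 1 / \<alpha>" for \<delta>
  proof -
    have "\<alpha> < 1 / \<delta>" using delta alpha by (simp add: field_simps)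
    then obtain a where a: "\<alpha> < a" "a < 1 / \<delta>" using dense by blast
    have tail: "\<forall>\<^sub>F x in at_top. x powr - a \<le> tail_plus \<phi> 0 x"
      by (rule powr_le_tail[OF heavy_line _ alpha(1) a(1)]) (simp add: tail_plus_def)
    have "\<delta> * a < 1" using a(2) delta by (simp add: field_simps)
    \<comment> \<open>The initial line is random, but it takes only countably many values.\<close>
    have "AE w in M. U 0 w = l0 \<longrightarrow> (\<forall>\<^sub>F t in sequentially. real t powr \<delta> \<le> rise t w)" for l0
    proof (cases "l0 \<in> A")
      case True
      show ?thesis
        by (rule AE_rise_ge_powr_from[OF drift[rule_format] b h[rule_format, OF True] tail])
           (use alpha a delta \<open>\<delta> * a < 1\<close> in auto)
    next
      case False
      show ?thesis by (rule AE_I2) (use False U_in_strip in auto)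
    qed
    then have "AE w in M. \<forall>l0. U 0 w = l0 \<longrightarrow> (\<forall>\<^sub>F t in sequentially. real t powr \<delta> \<le> rise t w)"
      by (subst AE_all_countable) (rule allI)
    then show ?thesis by simp
  qed

  have upper: "AE w in M. \<forall>\<^sub>F t in sequentially. real_of_int (V t w) \<le> real t powr \<gamma>" if gamma: "1 / \<alpha> < \<gamma>" for \<gamma>
  proof -
    obtain \<gamma>' where gamma': "1 / \<alpha> < \<gamma>'" "\<gamma>' < \<gamma>" using dense[OF gamma] by blast
    have "0 < \<gamma>" using gamma alpha by (meson less_trans zero_less_divide_1_iff)
    from rise_upper[OF gamma'(1)] show ?thesis
    proof (rule AE_mp, intro AE_I2 impI)
      fix w assume "\<forall>\<^sub>F t in sequentially. rise t w \<le> real t powr \<gamma>'"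
      with eventually_affine_powr_le[OF gamma'(2) \<open>0 < \<gamma>\<close>, of "real_of_int (V 0 w)" 1]
      show "\<forall>\<^sub>F t in sequentially. real_of_int (V t w) \<le> real t powr \<gamma>"
      proof eventually_elim
        case (elim t)
        have "0 \<le> fall t w" by (simp add: fall_def sum_nonneg)
        then show ?case using elim V_eq_rise_fall[of t w] by linarith
      qed
    qed
  qed

  \<comment> \<open>The rise exceeds \<open>t\<close> to a power larger than \<open>\<delta>\<close>, which absorbs \<open>V 0\<close>, the fall and \<open>t powr \<delta>\<close> itself.\<close>
  have lower: "AE w in M. \<forall>\<^sub>F t in sequentially. real t powr \<delta> \<le> real_of_int (V t w)"
    if delta: "1 / \<beta>' < \<delta>" "\<delta> < 1 / \<alpha>" for \<delta>
  proof -
    obtain \<delta>' where delta': "\<delta> < \<delta>'" "\<delta>' < 1 / \<alpha>" using dense[OF delta(2)] by blast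
    have pos: "0 < \<delta>'" using delta delta' rates by linarith
    show ?thesis
      using rise_lower[OF pos delta'(2)] fall_upper[OF delta(1)]
    proof eventually_elim
      case (elim w)
      from elim eventually_affine_powr_le[OF delta'(1) pos, of "- real_of_int (V 0 w)" 2]
      show ?case
      proof eventually_elim
        case (elim t)
        then show ?case using V_eq_rise_fall[of t w] by linarith
      qed
    qed
  qed

  have "AE w in M. (\<forall>q::rat. 1 / \<beta>' < of_rat q \<longrightarrow> of_rat q < 1 / \<alpha> \<longrightarrow>
        (\<forall>\<^sub>F t in sequentially. real t powr of_rat q \<le> real_of_int (V t w)))"
    unfolding AE_all_countable using lower by auto
  moreover have "AE w in M. (\<forall>q::rat. 1 / \<alpha> < of_rat q \<longrightarrow>
        (\<forall>\<^sub>F t in sequentially. real_of_int (V t w) \<le> real t powr of_rat q))"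
    unfolding AE_all_countable using upper by auto
  ultimately have log_limit: "AE w in M. (\<lambda>t. ln (real_of_int (V t w)) / ln (real t)) \<longlonglongrightarrow> 1 / \<alpha>"
    by eventually_elim (rule log_ratio_tendstoI[OF rates(2)], auto)

  obtain \<delta> where delta: "1 / \<beta>' < \<delta>" "\<delta> < 1 / \<alpha>" using dense[OF rates(2)] by blast
  from lower[OF delta] have transience: "AE w in M. filterlim (\<lambda>t. V t w) at_top sequentially"
  proof eventually_elim
    case (elim w)
    have "\<forall>\<^sub>F t in sequentially. Z \<le> V t w" for Z
    proof -
      have "0 < \<delta>" using delta rates by linarith
      from elim eventually_affine_powr_le[OF this this, of "real_of_int Z" 0] show ?thesis
        by eventually_elim simp
    qed
    then show ?case by (simp add: filterlim_at_top)
  qed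
  from transience log_limit show ?thesis by blast
qed

end
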